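(* For every positive integer $n$, every integer $m\ge2$ and all $x,y\in\mathbb{R}^m\setminus\{0\}$, the kernel of the $(0,2/n)$-generalized Fourier transform satisfies $|K^{m}_{2/n}(x,y)|\le1$.
   Context: For $a>0$, $m\ge2$, $\lambda=(m-2)/2$, $z=|x||y|$, $\xi=\langle x,y\rangle/z$, the kernel is $K_{a}^{m}(x,y)=a^{2\lambda/a}\Gamma(\frac{2\lambda+a}{a})\sum_{j=0}^{\infty}e^{-\frac{i\pi j}{a}}\frac{\lambda+j}{\lambda}z^{-\lambda}J_{\frac{2(j+\lambda)}{a}}(\frac{2}{a}z^{a/2})C^{\lambda}_{j}(\xi)$, with $J_\nu$ the Bessel function, $C_j^\lambda$ the Gegenbauer polynomial, and for $\lambda=0$ the factor $\frac{\lambda+j}{\lambda}C_j^\lambda(\xi)$ understood as its limit as $\lambda\to0$. *)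

theory Defs
  imports "HOL-Analysis.Analysis"
begin

definition bessel_J :: "real \<Rightarrow> real \<Rightarrow> real" where
  "bessel_J \<nu> t = (\<Sum>k. (-1) ^ k / (fact k * Gamma (real k + \<nu> + 1)) * (t / 2) powr (2 * real k + \<nu>))"

definition gegenbauer :: "real \<Rightarrow> nat \<Rightarrow> real \<Rightarrow> real" where
  "gegenbauer lam j x = (\<Sum>k\<le>j div 2. (-1) ^ k * pochhammer lam (j - k) / (fact k * fact (j - 2 * k)) * (2 * x) ^ (j - 2 * k))"

definition gegen_factor :: "real \<Rightarrow> nat \<Rightarrow> real \<Rightarrow> real" where
  "gegen_factor lam j \<xi> =
     (if lam = 0 then Lim (at 0) (\<lambda>l. (l + real j) / l * gegenbauer l j \<xi>)
      else (lam + real j) / lam * gegenbauer lam j \<xi>)"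

definition gen_fourier_kernel :: "real \<Rightarrow> 'a::euclidean_space \<Rightarrow> 'a \<Rightarrow> complex" where
  "gen_fourier_kernel a x y =
    (let m = real DIM('a); lam = (m - 2) / 2; z = norm x * norm y; \<xi> = (x \<bullet> y) / z in
     complex_of_real (a powr (2 * lam / a) * Gamma ((2 * lam + a) / a)) *
     (\<Sum>j. exp (- (\<i> * complex_of_real (pi * real j / a))) *
           complex_of_real (gegen_factor lam j \<xi> * z powr (- lam) *
             bessel_J (2 * (real j + lam) / a) ((2 / a) * z powr (a / 2)))))"

end

theory Submission
  imports Defs "HOL-Computational_Algebra.Polynomial_FPS"
begin

text \<open>
  Put \<open>\<lambda> = (m - 2) / 2\<close>, \<open>w = n z\<^sup>1\<^sup>/\<^sup>n\<close>, \<open>\<xi> = cos \<theta>\<close> and \<open>c\<^sub>k = cos ((\<theta> + 2 \<pi> k) / n)\<close>.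
  For \<open>\<lambda> > 0\<close> the kernel is the average of \<open>exp (- i w \<Sum>\<^sub>k c\<^sub>k p\<^sub>k)\<close> over the symmetric Dirichlet
  distribution with parameters \<open>\<lambda>, \<dots>, \<lambda>\<close> of \<open>(p\<^sub>0, \<dots>, p\<^sub>n\<^sub>-\<^sub>1)\<close>, hence bounded by 1; the case \<open>\<lambda> = 0\<close> is a limit.

  Expanding the Bessel functions, the kernel becomes \<open>\<Sum>\<^sub>N (- i w)\<^sup>N \<kappa>\<^sub>N\<close>, and the representation amounts to
  \<open>\<Sum>\<^sub>N \<kappa>\<^sub>N (n\<lambda>)\<^sub>N s\<^sup>N = \<Prod>\<^sub>k (1 - c\<^sub>k s)\<^sup>-\<^sup>\<lambda>\<close>, where \<open>(n\<lambda>)\<^sub>N\<close> is a Pochhammer symbol.  The substitution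
  \<open>s = 2 q / (1 + q\<^sup>2)\<close> turns both sides into \<open>(1 + q\<^sup>2)\<^sup>n\<^sup>\<lambda> (1 - 2 \<xi> q\<^sup>n + q\<^sup>2\<^sup>n)\<^sup>-\<^sup>\<lambda>\<close>: the right one because
  \<open>\<Prod>\<^sub>k (1 - 2 c\<^sub>k q + q\<^sup>2) = 1 - 2 \<xi> q\<^sup>n + q\<^sup>2\<^sup>n\<close>, the left one by the generating function of the Gegenbauer
  polynomials and the expansion of \<open>(1 + q\<^sup>2)\<^sup>\<nu>\<close> in powers of \<open>q\<^sup>2 / (1 + q\<^sup>2)\<^sup>2\<close>, whose coefficients are
  the ballot numbers.
\<close>

unbundle no vec_syntax
unbundle fps_syntax

section \<open>Real powers of formal power series\<close>

text \<open>The power \<open>P^a\<close> for a series with constant term 1, obtained by substituting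
  \<open>P - 1\<close> into the binomial series \<open>(1 + X)^a\<close>. The condition
  \<open>P $ 0 = 1\<close> in the lemmas below makes this substitution legitimate.\<close>

definition fps_rpow :: "real fps \<Rightarrow> real \<Rightarrow> real fps" where
  "fps_rpow P a = fps_binomial a oo (P - 1)"

lemma fps_rpow_nth_0 [simp]: "fps_rpow P a $ 0 = 1"
  by (simp add: fps_rpow_def)

lemma fps_rpow_add:
  assumes "P $ 0 = 1"
  shows "fps_rpow P (a + b) = fps_rpow P a * fps_rpow P b"
  using assms by (simp add: fps_rpow_def fps_binomial_add_mult fps_compose_mult_distrib)

lemma fps_rpow_0 [simp]: "fps_rpow P 0 = 1"
  by (simp add: fps_rpow_def)

lemma fps_rpow_of_nat:
  assumes "P $ 0 = 1"
  shows "fps_rpow P (real n) = P ^ n"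
  using assms
  by (simp add: fps_rpow_def fps_binomial_of_nat fps_compose_add_distrib
      flip: fps_compose_power)

lemma fps_rpow_compose:
  assumes "P $ 0 = 1" "s $ 0 = 0"
  shows "fps_rpow P a oo s = fps_rpow (P oo s) a"
proof -
  have "fps_binomial a oo ((P - 1) oo s) = fps_binomial a oo (P - 1) oo s"
    using assms by (intro fps_compose_assoc) auto
  then show ?thesis by (simp add: fps_rpow_def fps_compose_sub_distrib)
qed

lemma fps_rpow_deriv:
  assumes "P $ 0 = 1"
  shows "P * fps_deriv (fps_rpow P a) = fps_const a * fps_rpow P a * fps_deriv P"
proof -
  have "fps_deriv (fps_binomial a) * (1 + fps_X) = fps_const a * fps_binomial a"
  proof -
    have "(inverse (1 + fps_X) :: real fps) * (1 + fps_X) = 1"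
      by (rule inverse_mult_eq_1) simp
    then show ?thesis
      by (simp add: fps_binomial_deriv fps_divide_unit mult.assoc)
  qed
  then have "(fps_deriv (fps_binomial a) * (1 + fps_X)) oo (P - 1)
      = (fps_const a * fps_binomial a) oo (P - 1)"
    by simp
  then have "(fps_deriv (fps_binomial a) oo (P - 1)) * P = fps_const a * fps_rpow P a"
    using assms by (simp add: fps_compose_mult_distrib fps_compose_add_distrib fps_rpow_def)
  moreover have "fps_deriv (fps_rpow P a) = (fps_deriv (fps_binomial a) oo (P - 1)) * fps_deriv P"
    using assms by (simp add: fps_rpow_def fps_compose_deriv)
  ultimately show ?thesis by (simp add: mult_ac)
qed

text \<open>The quotient of two solutions of \<open>P f' = a f P'\<close> has derivative zero, and
  the constant terms make it 1. An identity between powers thus reduces to checking this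
  differential equation, as in \<open>fps_rpow_mult\<close>.\<close>

lemma fps_rpow_unique:
  assumes P: "P $ 0 = 1" and f0: "f $ 0 = 1"
    and f: "P * fps_deriv f = fps_const a * f * fps_deriv P"
  shows "f = fps_rpow P a"
proof -
  define g where "g = fps_rpow P a"
  have g: "P * fps_deriv g = fps_const a * g * fps_deriv P"
    unfolding g_def by (rule fps_rpow_deriv[OF P])
  have g0: "g $ 0 = 1" by (simp add: g_def)
  have ig: "inverse g * g = 1"
    by (rule inverse_mult_eq_1) (simp add: g0)
  have dg: "fps_deriv (inverse g) = - fps_deriv g * inverse g ^ 2"
    by (rule fps_inverse_deriv) (simp add: g0)
  have "P * fps_deriv (f * inverse g)
      = (P * fps_deriv f) * inverse g - f * (P * fps_deriv g) * inverse g ^ 2"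
    by (simp add: dg algebra_simps)
  also have "\<dots> = fps_const a * f * fps_deriv P * inverse g * (1 - inverse g * g)"
    unfolding f g by (simp add: algebra_simps power2_eq_square)
  also have "\<dots> = 0" by (simp add: ig)
  finally have "fps_deriv (f * inverse g) = 0"
    using P by (metis fps_zero_nth mult_eq_0_iff zero_neq_one)
  then have "f * inverse g = fps_const ((f * inverse g) $ 0)"
    by (simp only: fps_deriv_eq_0_iff)
  then have "f * inverse g = 1" by (simp add: f0 g0)
  then have "f * (inverse g * g) = g" by (metis mult.assoc mult.left_neutral)
  then have "f = g" by (simp only: ig mult_1_right)
  then show ?thesis by (simp only: g_def)
qed

lemma fps_rpow_mult:
  assumes "P $ 0 = 1" "Q $ 0 = 1"
  shows "fps_rpow (P * Q) a = fps_rpow P a * fps_rpow Q a"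
proof (rule fps_rpow_unique[symmetric])
  have "P * Q * fps_deriv (fps_rpow P a * fps_rpow Q a)
     = (P * fps_deriv (fps_rpow P a)) * Q * fps_rpow Q a
       + (Q * fps_deriv (fps_rpow Q a)) * P * fps_rpow P a"
    by (simp add: algebra_simps)
  then show "P * Q * fps_deriv (fps_rpow P a * fps_rpow Q a)
      = fps_const a * (fps_rpow P a * fps_rpow Q a) * fps_deriv (P * Q)"
    unfolding fps_rpow_deriv[OF assms(1)] fps_rpow_deriv[OF assms(2)]
    by (simp add: algebra_simps)
qed (use assms in auto)

lemma fps_rpow_prod:
  assumes "\<And>i. i \<in> A \<Longrightarrow> P i $ 0 = 1"
  shows "fps_rpow (\<Prod>i\<in>A. P i) a = (\<Prod>i\<in>A. fps_rpow (P i) a)"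
  using assms
proof (induction A rule: infinite_finite_induct)
  case (insert i A)
  have "(\<Prod>i\<in>A. P i) $ 0 = 1"
    using insert.hyps(1) insert.prems by (induction A rule: finite_induct) auto
  with insert show ?case by (simp add: fps_rpow_mult)
qed (simp_all add: fps_rpow_def)

section \<open>Coefficients of powers of linear and quadratic factors\<close>

lemma fps_rpow_linear_nth:
  "fps_rpow (1 - fps_const c * fps_X) (- a) $ N = pochhammer a N / fact N * c ^ N"
proof -
  have "fps_rpow (1 - fps_const c * fps_X) (- a) = fps_binomial (- a) oo (fps_const (- c) * fps_X)"
    by (simp add: fps_rpow_def flip: fps_const_neg)
  also have "\<dots> $ N = (- c) ^ N * (- a gchoose N)"
    by (simp add: fps_compose_linear)
  also have "\<dots> = pochhammer a N / fact N * c ^ N"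
    by (simp add: gbinomial_pochhammer flip: power_mult_distrib)
  finally show ?thesis .
qed

text \<open>The generating function of the Gegenbauer polynomials. The base is
  \<open>1 + X u\<close> with \<open>u = X - 2 \<xi>\<close>; the binomial series in
  \<open>X u\<close>, followed by the binomial theorem for the powers of \<open>u\<close>, yields
  the explicit finite sum.\<close>

lemma fps_rpow_gegenbauer_nth:
  "fps_rpow (1 - fps_const (2 * \<xi>) * fps_X + fps_X ^ 2) (- lam) $ j = gegenbauer lam j \<xi>"
proof -
  define u :: "real fps" where "u = fps_X - fps_const (2 * \<xi>)"
  have u: "(1 - fps_const (2 * \<xi>) * fps_X + fps_X ^ 2) - 1 = fps_X * u"
    by (simp add: u_def algebra_simps power2_eq_square)
  have un: "u ^ m $ i = (if i \<le> m then of_nat (m choose i) * (- (2 * \<xi>)) ^ (m - i) else 0)" for m i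
  proof -
    have "u ^ m = (fps_X + fps_const (- (2 * \<xi>))) ^ m" by (simp add: u_def flip: fps_const_neg)
    also have "\<dots> = (\<Sum>k\<le>m. of_nat (m choose k) * fps_X ^ k * fps_const (- (2 * \<xi>)) ^ (m - k))"
      by (rule binomial_ring)
    also have "\<dots> $ i = (\<Sum>k\<le>m. if k = i then of_nat (m choose i) * (- (2 * \<xi>)) ^ (m - i) else 0)"
      unfolding fps_sum_nth
      by (intro sum.cong refl)
         (auto simp: fps_const_power fps_of_nat[symmetric] simp del: fps_const_neg)
    finally show ?thesis by simp
  qed
  have "fps_rpow (1 - fps_const (2 * \<xi>) * fps_X + fps_X ^ 2) (- lam) $ j
      = (\<Sum>m=0..j. (- lam gchoose m) * (fps_X ^ m * u ^ m) $ j)"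
    by (simp add: fps_rpow_def u fps_compose_nth power_mult_distrib)
  also have "\<dots> = (\<Sum>m=0..j. (- lam gchoose m) * (u ^ m $ (j - m)))"
    by (intro sum.cong refl) (auto simp: fps_X_power_mult_nth)
  also have "\<dots> = (\<Sum>k=0..j. (- lam gchoose (j - k)) * (u ^ (j - k) $ k))"
    by (rule sum.reindex_bij_witness[of _ "\<lambda>k. j - k" "\<lambda>k. j - k"]) auto
  \<comment> \<open>\<open>u ^ (j - k)\<close> has degree \<open>j - k\<close>, so its coefficient
    at \<open>k\<close> vanishes once \<open>2 k > j\<close>.\<close>
  also have "\<dots> = (\<Sum>k\<le>j div 2. (- lam gchoose (j - k)) * (u ^ (j - k) $ k))"
    by (rule sum.mono_neutral_right) (auto simp: un)
  also have "\<dots> = gegenbauer lam j \<xi>"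
    unfolding gegenbauer_def
  proof (intro sum.cong refl)
    fix k assume "k \<in> {..j div 2}"
    then have k: "k \<le> j - k" "2 * k \<le> j" by auto
    have e: "j - k - k = j - 2 * k" by simp
    have b: "real (j - k choose k) = fact (j - k) / (fact k * fact (j - 2 * k))"
      using binomial_fact[OF k(1), where ?'a = real] unfolding e .
    have s: "(- 1) ^ (j - k) * (- (2 * \<xi>)) ^ (j - 2 * k) = (- 1) ^ k * (2 * \<xi>) ^ (j - 2 * k)"
    proof -
      define e :: real where "e = (- 1) ^ (j - 2 * k)"
      have "j - k = (j - 2 * k) + k" using k by simp
      then have "(- 1::real) ^ (j - k) = e * (- 1) ^ k"
        by (simp only: power_add e_def)
      moreover have "(- (2 * \<xi>)) ^ (j - 2 * k) = e * (2 * \<xi>) ^ (j - 2 * k)"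
        unfolding e_def by (rule power_minus)
      moreover have "e * e = 1"
        by (simp add: e_def minus_one_power_iff)
      moreover have "e * u * (e * v) = (e * e) * (u * v)" for u v :: real
        by (simp only: mult_ac)
      ultimately show ?thesis by (simp only: mult_1_left)
    qed
    have un': "u ^ (j - k) $ k = real (j - k choose k) * (- (2 * \<xi>)) ^ (j - 2 * k)"
      using un[of "j - k" k] k(1) unfolding e by (simp only: if_True)
    have "(- lam gchoose (j - k)) * (u ^ (j - k) $ k)
       = ((- 1) ^ (j - k) * (- (2 * \<xi>)) ^ (j - 2 * k)) * (pochhammer lam (j - k) / fact (j - k)
          * real (j - k choose k))"
      unfolding un' gbinomial_pochhammer minus_minus
      by (simp only: times_divide_eq_left times_divide_eq_right mult_ac)
    also have "\<dots> = (- 1) ^ k * pochhammer lam (j - k) / (fact k * fact (j - 2 * k)) * (2 * \<xi>) ^ (j - 2 * k)"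
      unfolding s b by simp
    finally show "(- lam gchoose (j - k)) * (u ^ (j - k) $ k)
      = (- 1) ^ k * pochhammer lam (j - k) / (fact k * fact (j - 2 * k)) * (2 * \<xi>) ^ (j - 2 * k)" .
  qed
  finally show ?thesis .
qed

section \<open>The ballot numbers\<close>

lemma pochhammer_forward_diff:
  fixes x :: real
  shows "pochhammer (x + 1) (Suc d) - pochhammer x (Suc d) = real (Suc d) * pochhammer (x + 1) d"
proof -
  have "pochhammer (x + 1) (Suc d) = pochhammer (x + 1) d * (x + 1 + real d)"
    by (rule pochhammer_Suc)
  moreover have "pochhammer x (Suc d) = x * pochhammer (x + 1) d"
    by (rule pochhammer_rec)
  ultimately show ?thesis by (simp add: algebra_simps)
qed

text \<open>Pascal's rule: a difference of order \<open>r + 1\<close> is a difference of order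
  \<open>r\<close> applied to the first differences.\<close>

lemma alternating_binomial_sum_Suc:
  fixes f :: "nat \<Rightarrow> real"
  shows "(\<Sum>k\<le>Suc r. (-1) ^ k * real (Suc r choose k) * f k)
    = (\<Sum>k\<le>r. (-1) ^ k * real (r choose k) * (f k - f (Suc k)))"
proof -
  have "(\<Sum>k\<le>Suc r. (-1) ^ k * real (Suc r choose k) * f k)
    = f 0 + (\<Sum>k\<le>r. (-1) ^ Suc k * real (Suc r choose Suc k) * f (Suc k))"
    by (subst sum.atMost_Suc_shift) simp
  also have "\<dots> = f 0 + (\<Sum>k\<le>r. (-1) ^ Suc k * real (r choose Suc k) * f (Suc k))
     - (\<Sum>k\<le>r. (-1) ^ k * real (r choose k) * f (Suc k))"
    by (simp add: algebra_simps sum.distrib sum_negf sum_subtractf)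
  also have "f 0 + (\<Sum>k\<le>r. (-1) ^ Suc k * real (r choose Suc k) * f (Suc k))
     = (\<Sum>k\<le>Suc r. (-1) ^ k * real (r choose k) * f k)"
    by (subst sum.atMost_Suc_shift) simp
  also have "\<dots> = (\<Sum>k\<le>r. (-1) ^ k * real (r choose k) * f k)"
    by simp
  finally show ?thesis by (simp add: algebra_simps sum_subtractf)
qed

text \<open>Each difference lowers the degree of a rising factorial by one, so \<open>r\<close> of
  them annihilate one of degree \<open>d < r\<close>.\<close>

lemma alternating_binomial_pochhammer_sum:
  fixes x :: real
  assumes "d < r"
  shows "(\<Sum>k\<le>r. (-1) ^ k * real (r choose k) * pochhammer (x + real k) d) = 0"
  using assms
proof (induction r arbitrary: d x)
  case (Suc r)
  have "(\<Sum>k\<le>Suc r. (-1) ^ k * real (Suc r choose k) * pochhammer (x + real k) d)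
    = (\<Sum>k\<le>r. (-1) ^ k * real (r choose k) *
         (pochhammer (x + real k) d - pochhammer (x + real (Suc k)) d))"
    by (rule alternating_binomial_sum_Suc)
  also have "\<dots> = 0"
  proof (cases d)
    case (Suc e)
    have *: "pochhammer (x + real k) d - pochhammer (x + real (Suc k)) d
        = - real d * pochhammer (x + 1 + real k) e" for k
      using pochhammer_forward_diff[of "x + real k" e] by (simp add: Suc algebra_simps)
    have "(\<Sum>k\<le>r. (-1) ^ k * real (r choose k) *
         (pochhammer (x + real k) d - pochhammer (x + real (Suc k)) d))
       = - real d * (\<Sum>k\<le>r. (-1) ^ k * real (r choose k) * pochhammer (x + 1 + real k) e)"
      unfolding * sum_distrib_left by (intro sum.cong) (auto simp: mult_ac)
    also have "\<dots> = 0"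
      using Suc.IH[of e "x + 1"] Suc.prems Suc by simp
    finally show ?thesis .
  qed simp
  finally show ?case .
qed simp

text \<open>
  \<open>ballot \<nu> k = \<nu> / (\<nu> + 2 k) binom (\<nu> + 2 k, k)\<close>, in a form that also makes sense for \<open>\<nu> + 2 k = 0\<close>.
  In \<open>ballot_convolution\<close> the product with a generalized binomial coefficient collapses to a polynomial
  of degree \<open>r - 1\<close> in \<open>k\<close>, which an alternating binomial sum of order \<open>r\<close> annihilates.
\<close>

definition ballot :: "real \<Rightarrow> nat \<Rightarrow> real" where
  "ballot \<nu> k = (if k = 0 then 1 else \<nu> * pochhammer (\<nu> + real k + 1) (k - 1) / fact k)"

text \<open>For \<open>k > 0\<close> the last factor of the rising factorial in
  \<open>ballot \<nu> k\<close> is \<open>\<nu> + 2 k - 1\<close>, just before the other one begins,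
  so the two merge. For \<open>k = 0\<close> the factor \<open>\<nu>\<close> is split off
  instead.\<close>

lemma ballot_mult_pochhammer:
  assumes "k \<le> r" "0 < r"
  shows "ballot \<nu> k * pochhammer (\<nu> + 2 * real k) (r - k)
    = \<nu> * pochhammer (\<nu> + 1 + real k) (r - 1) / fact k"
proof (cases k)
  case 0
  then show ?thesis
    using assms pochhammer_rec[of \<nu> "r - 1"] by (simp add: ballot_def)
next
  case (Suc i)
  have "r - 1 = i + (r - k)" using Suc assms by simp
  then have "pochhammer (\<nu> + 1 + real k) (r - 1)
      = pochhammer (\<nu> + 1 + real k) i * pochhammer (\<nu> + 1 + real k + real i) (r - k)"
    by (simp only: pochhammer_product')
  moreover have "\<nu> + 1 + real k + real i = \<nu> + 2 * real k" using Suc by simp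
  ultimately show ?thesis using Suc by (simp add: ballot_def algebra_simps)
qed

lemma ballot_convolution:
  "(\<Sum>k\<le>r. ballot \<nu> k * (- (2 * real k + \<nu>) gchoose (r - k))) = (if r = 0 then 1 else 0)"
proof (cases "r = 0")
  case False
  have "ballot \<nu> k * (- (2 * real k + \<nu>) gchoose (r - k))
      = (-1) ^ r * \<nu> / fact r *
          ((-1) ^ k * real (r choose k) * pochhammer (\<nu> + 1 + real k) (r - 1))"
    if "k \<le> r" for k
  proof -
    have s: "(-1::real) ^ (r - k) = (-1) ^ r * (-1) ^ k"
      using that by (simp add: minus_one_power_iff)
    have "ballot \<nu> k * (- (2 * real k + \<nu>) gchoose (r - k))
       = (-1) ^ (r - k) * (ballot \<nu> k * pochhammer (\<nu> + 2 * real k) (r - k)) / fact (r - k)"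
      by (simp add: gbinomial_pochhammer add.commute)
    also have "ballot \<nu> k * pochhammer (\<nu> + 2 * real k) (r - k)
        = \<nu> * pochhammer (\<nu> + 1 + real k) (r - 1) / fact k"
      using that False by (intro ballot_mult_pochhammer) auto
    finally show ?thesis
      using that by (simp add: s binomial_fact)
  qed
  then have "(\<Sum>k\<le>r. ballot \<nu> k * (- (2 * real k + \<nu>) gchoose (r - k)))
     = (-1) ^ r * \<nu> / fact r *
        (\<Sum>k\<le>r. (-1) ^ k * real (r choose k) * pochhammer (\<nu> + 1 + real k) (r - 1))"
    unfolding sum_distrib_left by (intro sum.cong) auto
  with False show ?thesis by (simp add: alternating_binomial_pochhammer_sum)
qed (simp add: ballot_def)

text \<open>Turns the coefficients of the Bessel series into ballot numbers; it is applied with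
  \<open>\<alpha> = n \<lambda>\<close> and \<open>i = n j\<close>. For \<open>k > 0\<close> the
  first \<open>k + i + 1\<close> factors of the numerator cancel \<open>\<alpha>\<close> and the
  Pochhammer symbol below.\<close>

lemma ballot_eq_pochhammer:
  assumes "\<alpha> > 0"
  shows "pochhammer \<alpha> (i + 2 * k) * ((\<alpha> + real i) / \<alpha>) / (fact k * pochhammer (\<alpha> + 1) (k + i))
    = ballot (\<alpha> + real i) k"
proof (cases k)
  case 0
  have "\<alpha> * pochhammer (\<alpha> + 1) i = pochhammer \<alpha> i * (\<alpha> + real i)"
    by (metis pochhammer_Suc pochhammer_rec)
  moreover have "pochhammer (\<alpha> + 1) i > 0" using assms by (intro pochhammer_pos) auto
  moreover have "pochhammer \<alpha> i > 0" using assms by (rule pochhammer_pos)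
  ultimately show ?thesis using 0 assms by (simp add: ballot_def divide_simps)
next
  case (Suc l)
  have "i + 2 * k = Suc (k + i) + l" using Suc by simp
  then have "pochhammer \<alpha> (i + 2 * k)
      = pochhammer \<alpha> (Suc (k + i)) * pochhammer (\<alpha> + real (Suc (k + i))) l"
    by (simp only: pochhammer_product')
  also have "pochhammer \<alpha> (Suc (k + i)) = \<alpha> * pochhammer (\<alpha> + 1) (k + i)"
    by (rule pochhammer_rec)
  also have "\<alpha> + real (Suc (k + i)) = \<alpha> + real i + real k + 1" by simp
  finally have e: "pochhammer \<alpha> (i + 2 * k)
      = \<alpha> * pochhammer (\<alpha> + 1) (k + i) * pochhammer (\<alpha> + real i + real k + 1) l" .
  have "pochhammer (\<alpha> + 1) (k + i) > 0" using assms by (intro pochhammer_pos) auto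
  then show ?thesis
    unfolding e using Suc assms by (simp add: ballot_def divide_simps)
qed

section \<open>Substitution of q / (1 + q^2)\<close>

lemma fps_rpow_power:
  assumes "P $ 0 = 1"
  shows "fps_rpow P a ^ N = fps_rpow P (real N * a)"
  by (induction N) (simp_all add: assms fps_rpow_add algebra_simps)

lemma fps_compose_nth_atMost:
  fixes f s :: "real fps"
  assumes "s $ 0 = 0" "r \<le> R"
  shows "(f oo s) $ r = (\<Sum>i\<le>R. f $ i * (s ^ i $ r))"
  unfolding fps_compose_nth using assms startsby_zero_power_prefix[OF assms(1)]
  by (intro sum.mono_neutral_left) auto

lemma fps_mult_nth_cong_right:
  fixes B E E' :: "real fps"
  assumes "\<And>i. i \<le> r \<Longrightarrow> E $ i = E' $ i"
  shows "(B * E) $ r = (B * E') $ r"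
  unfolding fps_mult_nth using assms by (intro sum.cong) auto

text \<open>Indexes the terms of degree \<open>N\<close> in \<open>w\<close>: the Gegenbauer index
  \<open>j\<close> contributes degree \<open>n j\<close>, the index \<open>k\<close> of the Bessel
  series contributes \<open>2 k\<close>.\<close>

definition weighted_pairs :: "nat \<Rightarrow> nat \<Rightarrow> (nat \<times> nat) set" where
  "weighted_pairs n N = {(j, k). n * j + 2 * k = N}"

lemma weighted_pairs_subset: "n > 0 \<Longrightarrow> weighted_pairs n N \<subseteq> {..N} \<times> {..N}"
  by (auto simp: weighted_pairs_def trans_le_add1)

lemma finite_weighted_pairs: "n > 0 \<Longrightarrow> finite (weighted_pairs n N)"
  by (rule finite_subset[OF weighted_pairs_subset]) auto

text \<open>The series \<open>q / (1 + q^2)\<close>, without the factor 2 of the substitution for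
  \<open>s\<close>. Its compositional inverse is \<open>X C(X^2)\<close> with \<open>C\<close> the
  generating function of the Catalan numbers.\<close>

definition catalan_subst :: "real fps" where
  "catalan_subst = fps_X * fps_rpow (1 + fps_X ^ 2) (- 1)"

lemma catalan_subst_nth_0 [simp]: "catalan_subst $ 0 = 0"
  by (simp add: catalan_subst_def)

lemma catalan_subst_nth_1 [simp]: "catalan_subst $ Suc 0 = 1"
  by (simp add: catalan_subst_def)

lemma catalan_subst_mult: "catalan_subst * (1 + fps_X ^ 2) = fps_X"
proof -
  let ?P = "1 + fps_X ^ 2 :: real fps"
  have P: "?P $ 0 = 1" by simp
  have "fps_rpow ?P (- 1) * ?P = fps_rpow ?P (- 1) * fps_rpow ?P (real 1)"
    using fps_rpow_of_nat[OF P, of 1] by simp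
  also have "\<dots> = 1" using fps_rpow_add[OF P, of "-1" "real 1"] by simp
  finally show ?thesis by (simp add: catalan_subst_def mult.assoc)
qed

lemma catalan_subst_power:
  "catalan_subst ^ N = fps_X ^ N * fps_rpow (1 + fps_X ^ 2) (- real N)"
  by (simp add: catalan_subst_def power_mult_distrib fps_rpow_power)

text \<open>This is the expansion of \<open>(1 + q^2)^\<nu>\<close> in powers of
  \<open>q^2 / (1 + q^2)^2\<close>, divided by \<open>(1 + q^2)^\<nu>\<close> and truncated. In the
  variable \<open>q^2\<close> its coefficients are the sums in
  \<open>ballot_convolution\<close>.\<close>

lemma ballot_sum_catalan_subst:
  assumes "i \<le> r"
  shows "(\<Sum>k\<le>r. fps_const (ballot \<nu> k) * fps_X ^ (2 * k) *
     fps_rpow (1 + fps_X ^ 2) (- (2 * real k + \<nu>))) $ i = (1 :: real fps) $ i"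
proof -
  define D :: "real fps" where
    "D = (\<Sum>k\<le>r. fps_const (ballot \<nu> k) * (fps_X ^ k * fps_binomial (- (2 * real k + \<nu>))))"
  have D: "D $ l = (1 :: real fps) $ l" if "l \<le> r" for l
  proof -
    have "D $ l = (\<Sum>k\<le>r. if l < k then 0 else ballot \<nu> k * (- (2 * real k + \<nu>) gchoose (l - k)))"
      by (auto simp: D_def fps_sum_nth fps_X_power_mult_nth intro!: sum.cong)
    also have "\<dots> = (\<Sum>k\<le>l. ballot \<nu> k * (- (2 * real k + \<nu>) gchoose (l - k)))"
      using that by (intro sum.mono_neutral_cong_right) auto
    also have "\<dots> = (if l = 0 then 1 else 0)" by (rule ballot_convolution)
    finally show ?thesis by simp
  qed
  have "(\<Sum>k\<le>r. fps_const (ballot \<nu> k) * fps_X ^ (2 * k) *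
     fps_rpow (1 + fps_X ^ 2) (- (2 * real k + \<nu>))) = D oo fps_X ^ 2"
    unfolding D_def fps_compose_sum_distrib
    by (intro sum.cong refl)
       (simp add: fps_compose_mult_distrib fps_rpow_def fps_X_power_compose power_mult mult.assoc)
  also have "\<dots> $ i = (1 oo fps_X ^ 2) $ i"
    unfolding fps_compose_nth by (intro sum.cong) (use assms D in auto)
  finally show ?thesis by simp
qed

text \<open>After composition the sum over \<open>k\<close> can be carried out for each fixed
  \<open>j\<close>: by \<open>ballot_sum_catalan_subst\<close> it equals
  \<open>X^(n j) (1 + X^2)^\<alpha>\<close>, and the power of \<open>1 + X^2\<close> no longer
  depends on \<open>j\<close>.\<close>

lemma ballot_transform_compose:
  assumes n: "n > 0"
  shows "Abs_fps (\<lambda>N. \<Sum>(j, k)\<in>weighted_pairs n N. ballot (\<alpha> + real (n * j)) k * C j) oo catalan_subst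
    = fps_rpow (1 + fps_X ^ 2) \<alpha> * (Abs_fps C oo fps_X ^ n)"
proof (rule fps_ext)
  fix r
  let ?P = "1 + fps_X ^ 2 :: real fps"
  have P: "?P $ 0 = 1" by simp
  define T where "T = (\<lambda>(j, k). ballot (\<alpha> + real (n * j)) k * C j * (catalan_subst ^ (n * j + 2 * k) $ r))"
  have inner: "(\<Sum>k\<le>r. ballot (\<alpha> + real (n * j)) k * (catalan_subst ^ (n * j + 2 * k) $ r))
     = (fps_X ^ (n * j) * fps_rpow ?P \<alpha>) $ r" for j
  proof -
    let ?\<nu> = "\<alpha> + real (n * j)"
    have "fps_rpow ?P (- real (n * j + 2 * k)) = fps_rpow ?P \<alpha> * fps_rpow ?P (- (2 * real k + ?\<nu>))" for k
      by (subst fps_rpow_add[OF P, symmetric]) (simp add: algebra_simps)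
    then have "(\<Sum>k\<le>r. fps_const (ballot ?\<nu> k) * catalan_subst ^ (n * j + 2 * k))
      = (fps_X ^ (n * j) * fps_rpow ?P \<alpha>) *
        (\<Sum>k\<le>r. fps_const (ballot ?\<nu> k) * fps_X ^ (2 * k) * fps_rpow ?P (- (2 * real k + ?\<nu>)))"
      unfolding catalan_subst_power sum_distrib_left
      by (intro sum.cong refl) (simp only: power_add mult_ac)
    also have "\<dots> $ r = (fps_X ^ (n * j) * fps_rpow ?P \<alpha> * 1) $ r"
      by (intro fps_mult_nth_cong_right ballot_sum_catalan_subst)
    finally show ?thesis by (simp add: fps_sum_nth)
  qed
  have "(Abs_fps (\<lambda>N. \<Sum>(j, k)\<in>weighted_pairs n N. ballot (\<alpha> + real (n * j)) k * C j) oo catalan_subst) $ r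
     = (\<Sum>N\<le>r. \<Sum>p\<in>weighted_pairs n N. T p)"
    unfolding fps_compose_nth_atMost[OF catalan_subst_nth_0 order.refl]
    by (auto simp: T_def sum_distrib_right weighted_pairs_def intro!: sum.cong)
  also have "\<dots> = (\<Sum>p\<in>(\<Union>N\<le>r. weighted_pairs n N). T p)"
    by (subst sum.UNION_disjoint) (auto simp: finite_weighted_pairs[OF n], auto simp: weighted_pairs_def)
  \<comment> \<open>The added pairs have \<open>n j + 2 k > r\<close>, and that power of
    \<open>catalan_subst\<close> has no term of degree \<open>r\<close>.\<close>
  also have "\<dots> = (\<Sum>p\<in>{..r} \<times> {..r}. T p)"
  proof (rule sum.mono_neutral_left)
    show "(\<Union>N\<le>r. weighted_pairs n N) \<subseteq> {..r} \<times> {..r}"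
      using weighted_pairs_subset[OF n] by fastforce
    show "\<forall>p\<in>{..r} \<times> {..r} - (\<Union>N\<le>r. weighted_pairs n N). T p = 0"
      using startsby_zero_power_prefix[OF catalan_subst_nth_0]
      by (auto simp: T_def weighted_pairs_def)
  qed auto
  also have "\<dots> = (\<Sum>j\<le>r. C j * (\<Sum>k\<le>r. ballot (\<alpha> + real (n * j)) k * (catalan_subst ^ (n * j + 2 * k) $ r)))"
    by (simp add: sum.cartesian_product[symmetric] T_def sum_distrib_left mult_ac)
  also have "\<dots> = (fps_rpow ?P \<alpha> * (\<Sum>j\<le>r. fps_const (C j) * fps_X ^ (n * j))) $ r"
    unfolding inner sum_distrib_left fps_sum_nth by (intro sum.cong refl) (simp add: mult_ac)
  also have "\<dots> = (fps_rpow ?P \<alpha> * (Abs_fps C oo fps_X ^ n)) $ r"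
  proof (rule fps_mult_nth_cong_right)
    fix i assume "i \<le> r"
    then show "(\<Sum>j\<le>r. fps_const (C j) * fps_X ^ (n * j)) $ i = (Abs_fps C oo fps_X ^ n) $ i"
      using n by (subst fps_compose_nth_atMost[of _ i r]) (auto simp: fps_sum_nth power_mult)
  qed
  finally show "(Abs_fps (\<lambda>N. \<Sum>(j, k)\<in>weighted_pairs n N. ballot (\<alpha> + real (n * j)) k * C j) oo catalan_subst) $ r
     = (fps_rpow ?P \<alpha> * (Abs_fps C oo fps_X ^ n)) $ r" .
qed

section \<open>The product of quadratic factors\<close>

text \<open>Both sides are monic polynomials of degree \<open>n\<close> in \<open>q\<close> that
  vanish at the \<open>n\<close> distinct \<open>n\<close>-th roots of \<open>cis \<theta>\<close>.
  Equal leading coefficients let \<open>n\<close> common values suffice.\<close>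

lemma prod_diff_roots_cis:
  fixes q :: complex
  assumes n: "n > 0"
  shows "(\<Prod>k<n. (q - cis ((\<theta> + 2 * pi * real k) / real n))) = q ^ n - cis \<theta>"
proof -
  let ?\<zeta> = "\<lambda>k. cis ((\<theta> + 2 * pi * real k) / real n)"
  define p where "p = (\<Prod>k<n. [:- ?\<zeta> k, 1:])"
  define r where "r = monom 1 n - [:cis \<theta>:]"
  have \<zeta>: "?\<zeta> k = cis (\<theta> / real n) * cis (2 * pi * real k / real n)" for k
    by (simp add: cis_mult add_divide_distrib)
  have "inj_on (\<lambda>k. cis (2 * pi * real k / real n)) {..<n}"
    using Complex.bij_betw_roots_unity[OF n] by (simp add: bij_betw_def)
  then have inj: "inj_on ?\<zeta> {..<n}"
    unfolding \<zeta> inj_on_def by simp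
  have pow: "?\<zeta> k ^ n = cis \<theta>" for k
  proof -
    have "?\<zeta> k ^ n = cis (\<theta> + 2 * pi * real k)" using n by (simp add: Complex.DeMoivre)
    also have "\<dots> = cis \<theta> * cis (2 * pi) ^ k" by (simp add: cis_mult Complex.DeMoivre mult_ac)
    finally show ?thesis by simp
  qed
  have dp: "degree p = n" unfolding p_def by (subst degree_prod_eq_sum_degree) auto
  have lp: "lead_coeff p = 1" unfolding p_def by (subst lead_coeff_prod) auto
  have dr: "degree r \<le> n" unfolding r_def
    by (intro degree_diff_le degree_monom_le) auto
  have "p = r"
  proof (rule poly_eqI_degree_lead_coeff[of p n r "?\<zeta> ` {..<n}"])
    show "coeff p n = coeff r n" using dp lp n by (cases n) (auto simp: r_def)
    show "card (?\<zeta> ` {..<n}) \<ge> n" using inj by (simp add: card_image)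
    show "poly p z = poly r z" if z: "z \<in> ?\<zeta> ` {..<n}" for z
    proof -
      obtain k where k: "k < n" "z = ?\<zeta> k" using z by blast
      have "poly p z = (\<Prod>i<n. (z - ?\<zeta> i))" by (simp add: p_def poly_prod)
      also have "\<dots> = 0" using k by (intro prod_zero) auto
      finally show ?thesis using pow[of k] by (simp add: r_def poly_monom k)
    qed
  qed (use dp dr in auto)
  then have "poly p q = poly r q" by simp
  then show ?thesis by (simp add: p_def r_def poly_prod poly_monom)
qed

lemma norm_diff_cis_squared: "(norm (complex_of_real q - cis \<phi>))\<^sup>2 = 1 - 2 * cos \<phi> * q + q\<^sup>2"
proof -
  have "(norm (complex_of_real q - cis \<phi>))\<^sup>2 = (q - cos \<phi>)\<^sup>2 + (sin \<phi>)\<^sup>2"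
    by (simp add: cmod_power2)
  also have "\<dots> = q\<^sup>2 - 2 * cos \<phi> * q + ((cos \<phi>)\<^sup>2 + (sin \<phi>)\<^sup>2)"
    by (simp add: power2_diff)
  finally show ?thesis by simp
qed

text \<open>The squared modulus of \<open>prod_diff_roots_cis\<close> at a real
  \<open>q\<close>.\<close>

lemma prod_quadratic_cos:
  fixes q \<theta> :: real
  assumes "n > 0"
  shows "(\<Prod>k<n. (1 - 2 * cos ((\<theta> + 2 * pi * real k) / real n) * q + q\<^sup>2))
    = 1 - 2 * cos \<theta> * q ^ n + (q ^ n)\<^sup>2"
  using arg_cong[OF prod_diff_roots_cis[OF assms, of "complex_of_real q" \<theta>], of "\<lambda>z. (norm z)\<^sup>2"]
  by (simp add: norm_diff_cis_squared prod_power_distrib prod_norm[symmetric] flip: of_real_power)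

lemma fps_prod_quadratic_cos:
  fixes \<theta> :: real
  assumes n: "n > 0"
  shows "(\<Prod>k<n. (1 - fps_const (2 * cos ((\<theta> + 2 * pi * real k) / real n)) * fps_X + fps_X\<^sup>2))
    = 1 - fps_const (2 * cos \<theta>) * fps_X ^ n + (fps_X ^ n)\<^sup>2"
proof -
  define p where "p = (\<Prod>k<n. [:1, - 2 * cos ((\<theta> + 2 * pi * real k) / real n), 1:])"
  define r where "r = 1 - monom (2 * cos \<theta>) n + monom 1 (n * 2)"
  have "poly p q = poly r q" for q
    using prod_quadratic_cos[OF n, of \<theta> q]
    by (simp add: p_def r_def poly_prod poly_monom power_mult algebra_simps power2_eq_square)
  then have "p = r" by (simp add: poly_eq_poly_eq_iff[symmetric] fun_eq_iff)
  then have "fps_of_poly p = fps_of_poly r" by simp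
  then show ?thesis
    by (simp add: p_def r_def fps_of_poly_prod fps_of_poly_pCons fps_of_poly_monom fps_of_poly_diff
        fps_of_poly_add power_mult algebra_simps power2_eq_square flip: fps_const_neg)
qed

text \<open>The generating functions in \<open>N\<close> of both sides are compared after
  composition with \<open>catalan_subst\<close>. The factor \<open>2 ^ N\<close> accounts for the
  rescaling \<open>X\<close> to \<open>2 X\<close> left out of that series.\<close>

lemma gegenbauer_ballot_transform:
  fixes lam \<theta> :: real
  assumes n: "n > 0"
  shows "(\<Sum>(j, k)\<in>weighted_pairs n N. ballot (real n * lam + real (n * j)) k * gegenbauer lam j (cos \<theta>))
    = 2 ^ N * (\<Prod>k<n. fps_rpow (1 - fps_const (cos ((\<theta> + 2 * pi * real k) / real n)) * fps_X) (- lam)) $ N"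
proof -
  let ?P = "1 + fps_X ^ 2 :: real fps"
  define c where "c = (\<lambda>k. cos ((\<theta> + 2 * pi * real k) / real n))"
  define Q where "Q = (\<lambda>x::real. 1 - fps_const (2 * x) * fps_X + fps_X\<^sup>2)"
  define L where "L = (\<lambda>x::real. 1 - fps_const x * fps_X)"
  define g where "g = Abs_fps (\<lambda>N. \<Sum>(j, k)\<in>weighted_pairs n N.
      ballot (real n * lam + real (n * j)) k * gegenbauer lam j (cos \<theta>))"
  define h where "h = (\<Prod>k<n. fps_rpow (L (c k)) (- lam))"
  have P0: "?P $ 0 = 1" and Q0: "Q x $ 0 = 1" and L0: "L x $ 0 = 1" for x
    by (simp_all add: Q_def L_def)
  have gegen: "Abs_fps (\<lambda>j. gegenbauer lam j (cos \<theta>)) = fps_rpow (Q (cos \<theta>)) (- lam)"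
    by (rule fps_ext) (simp add: Q_def fps_rpow_gegenbauer_nth)
  have L_comp: "L x oo (fps_const 2 * fps_X) = L (2 * x)" for x
    by (simp add: L_def fps_compose_sub_distrib fps_compose_mult_distrib mult_ac flip: fps_const_mult)
  \<comment> \<open>Clearing the denominator of \<open>1 - 2 x q / (1 + q^2)\<close> leaves the
    quadratic \<open>Q x\<close>.\<close>
  have LQ: "fps_rpow (L (2 * x) oo catalan_subst) (- lam) * fps_rpow ?P (- lam) = fps_rpow (Q x) (- lam)" for x
  proof -
    have "(L (2 * x) oo catalan_subst) * ?P = Q x"
    proof -
      have "(L (2 * x) oo catalan_subst) * ?P = ?P - fps_const (2 * x) * (catalan_subst * ?P)"
        by (simp add: L_def fps_compose_sub_distrib fps_compose_mult_distrib algebra_simps)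
      then show ?thesis unfolding catalan_subst_mult by (simp add: Q_def)
    qed
    then show ?thesis
      using fps_rpow_mult[OF _ P0, of "L (2 * x) oo catalan_subst" "- lam"] L0 by simp
  qed
  have "(\<Prod>k<n. fps_rpow (L (2 * c k) oo catalan_subst) (- lam)) * fps_rpow ?P (- lam) ^ n
      = (\<Prod>k<n. fps_rpow (L (2 * c k) oo catalan_subst) (- lam) * fps_rpow ?P (- lam))"
    by (simp add: prod.distrib)
  also have "\<dots> = (\<Prod>k<n. fps_rpow (Q (c k)) (- lam))"
    by (simp only: LQ)
  also have "\<dots> = fps_rpow (\<Prod>k<n. Q (c k)) (- lam)"
    by (rule fps_rpow_prod[symmetric]) (simp add: Q0)
  also have "(\<Prod>k<n. Q (c k)) = Q (cos \<theta>) oo fps_X ^ n"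
    using n unfolding Q_def c_def fps_prod_quadratic_cos[OF n]
    by (simp add: fps_compose_add_distrib fps_compose_sub_distrib fps_compose_mult_distrib
        fps_X_power_compose)
  also have "fps_rpow \<dots> (- lam) = fps_rpow (Q (cos \<theta>)) (- lam) oo fps_X ^ n"
    using n by (simp add: fps_rpow_compose Q0)
  finally have prod: "(\<Prod>k<n. fps_rpow (L (2 * c k) oo catalan_subst) (- lam)) * fps_rpow ?P (- (real n * lam))
      = fps_rpow (Q (cos \<theta>)) (- lam) oo fps_X ^ n"
    by (simp add: fps_rpow_power P0)
  have inv: "fps_rpow ?P (- (real n * lam)) * fps_rpow ?P (real n * lam) = 1"
    by (simp add: P0 flip: fps_rpow_add)
  have "g oo catalan_subst = fps_rpow ?P (real n * lam) * (fps_rpow (Q (cos \<theta>)) (- lam) oo fps_X ^ n)"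
    unfolding g_def ballot_transform_compose[OF n] gegen ..
  also have "\<dots> = (\<Prod>k<n. fps_rpow (L (2 * c k) oo catalan_subst) (- lam))
      * (fps_rpow ?P (- (real n * lam)) * fps_rpow ?P (real n * lam))"
    unfolding prod[symmetric] by (simp only: mult_ac)
  also have "\<dots> = (\<Prod>k<n. fps_rpow (L (2 * c k)) (- lam)) oo catalan_subst"
    by (simp add: inv fps_compose_prod_distrib fps_rpow_compose L0)
  \<comment> \<open>Composition with \<open>catalan_subst\<close> is injective because its constant
    term is 0 and its linear coefficient is 1.\<close>
  finally have "g = (\<Prod>k<n. fps_rpow (L (2 * c k)) (- lam))"
    by (simp add: fps_compose_inj_right)
  also have "\<dots> = h oo (fps_const 2 * fps_X)"
    by (simp add: h_def fps_compose_prod_distrib fps_rpow_compose L0 L_comp)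
  finally have "g $ N = 2 ^ N * h $ N" by (simp add: fps_compose_linear)
  then show ?thesis by (simp add: g_def h_def L_def c_def)
qed

section \<open>Mixtures of exponentials over the Dirichlet distribution\<close>

text \<open>The Beta density times \<open>p^i (1 - p)^j\<close> is again an unnormalized Beta
  density, so each mixed moment is a ratio of two Beta functions. The case \<open>i = j = 0\<close>
  says that the total mass is 1.\<close>

lemma beta_distribution_exists:
  fixes a b :: real
  assumes a: "a > 0" and b: "b > 0"
  obtains M :: "real measure" where "finite_measure M" "sets M = sets borel"
    "AE p in M. 0 \<le> p \<and> p \<le> 1"
    "\<And>i j. (\<integral>p. p ^ i * (1 - p) ^ j \<partial>M) = pochhammer a i * pochhammer b j / pochhammer (a + b) (i + j)"
proof -
  define D where "D = (\<lambda>p. indicator {0..1} p * (p powr (a - 1) * (1 - p) powr (b - 1)) / Beta a b :: real)"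
  define M where "M = density lborel (\<lambda>p. ennreal (D p))"
  have Bpos: "Beta a b > 0"
    using a b by (simp add: Beta_def)
  have D0: "D p \<ge> 0" for p using Bpos by (simp add: D_def)
  have D_meas [measurable]: "D \<in> borel_measurable borel" unfolding D_def by measurable
  have mono: "D p * (p ^ i * (1 - p) ^ j)
     = indicator {0..1} p *\<^sub>R (p powr (a + real i - 1) * (1 - p) powr (b + real j - 1)) / Beta a b" for p i j
  proof (cases "p \<in> {0..1}")
    case True
    \<comment> \<open>At \<open>x = 0\<close> both sides are 0 because \<open>powr\<close> with base
      0 is 0 for every exponent.\<close>
    have pw: "x powr (y - 1) * x ^ k = x powr (y + real k - 1)" if "x \<ge> 0" for x y k
    proof (cases "x = 0")
      case False
      then have "x powr (y - 1) * x powr real k = x powr (y - 1 + real k)"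
        by (simp flip: powr_add)
      with False that show ?thesis by (simp add: powr_realpow algebra_simps)
    qed simp
    have "D p * (p ^ i * (1 - p) ^ j)
       = (p powr (a - 1) * p ^ i) * ((1 - p) powr (b - 1) * (1 - p) ^ j) / Beta a b"
      using True by (simp add: D_def)
    then show ?thesis using True by (simp add: pw)
  qed (simp add: D_def)
  have Beta: "integrable lborel (\<lambda>p. D p * (p ^ i * (1 - p) ^ j))"
    "(\<integral>p. D p * (p ^ i * (1 - p) ^ j) \<partial>lborel) = Beta (a + real i) (b + real j) / Beta a b" for i j
  proof -
    have ai: "a + real i > 0" "b + real j > 0" using a b by auto
    have int: "set_integrable lborel {0..1} (\<lambda>p. p powr (a + real i - 1) * (1 - p) powr (b + real j - 1))"
      using integrable_Beta[OF ai] .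
    show "integrable lborel (\<lambda>p. D p * (p ^ i * (1 - p) ^ j))"
      using int unfolding mono set_integrable_def by (intro integrable_divide)
    have "(LINT p:{0..1}|lborel. p powr (a + real i - 1) * (1 - p) powr (b + real j - 1))
       = Beta (a + real i) (b + real j)"
      using set_borel_integral_eq_integral(2)[OF int] has_integral_Beta_real[OF ai]
      by (simp add: integral_unique)
    then show "(\<integral>p. D p * (p ^ i * (1 - p) ^ j) \<partial>lborel) = Beta (a + real i) (b + real j) / Beta a b"
      unfolding mono set_lebesgue_integral_def by simp
  qed
  have ratio: "Beta (a + real i) (b + real j) / Beta a b
      = pochhammer a i * pochhammer b j / pochhammer (a + b) (i + j)" for i j
  proof -
    have "a \<notin> \<int>\<^sub>\<le>\<^sub>0" "b \<notin> \<int>\<^sub>\<le>\<^sub>0" "a + b \<notin> \<int>\<^sub>\<le>\<^sub>0"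
      using a b by (auto elim!: nonpos_Ints_cases)
    moreover have "a + real i + (b + real j) = a + b + real (i + j)" by simp
    moreover have "Gamma a > 0" "Gamma b > 0" "Gamma (a + b) > 0" "Gamma (a + b + real (i + j)) > 0"
      using a b by (auto intro!: Gamma_real_pos)
    ultimately show ?thesis by (simp add: Beta_def pochhammer_Gamma field_simps)
  qed
  show ?thesis
  proof (rule that[of M])
    have "emeasure M (space M) = (\<integral>\<^sup>+p. ennreal (D p) \<partial>lborel)"
      by (simp add: M_def emeasure_density)
    also have "\<dots> = ennreal (\<integral>p. D p \<partial>lborel)"
      using Beta(1)[of 0 0] D0 by (intro nn_integral_eq_integral) auto
    finally show "finite_measure M" by (intro finite_measureI) simp
    show "sets M = sets borel" by (simp add: M_def)
    show "AE p in M. 0 \<le> p \<and> p \<le> 1"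
      unfolding M_def by (subst AE_density) (auto simp: D_def indicator_def)
    show "(\<integral>p. p ^ i * (1 - p) ^ j \<partial>M) = pochhammer a i * pochhammer b j / pochhammer (a + b) (i + j)" for i j
      unfolding M_def using D0 by (subst integral_density) (auto simp: Beta(2) ratio)
  qed
qed

text \<open>If \<open>h $ N / pochhammer a N\<close> is the \<open>N\<close>-th moment of a bounded
  random variable \<open>Y\<close> divided by \<open>fact N\<close>, this is the expectation of
  \<open>exp (- i w Y)\<close>. For the Dirichlet mixture, \<open>Y\<close> is the sum of the
  \<open>c k * p k\<close>.\<close>

definition mixture_series :: "real \<Rightarrow> real fps \<Rightarrow> real \<Rightarrow> complex" where
  "mixture_series a h w = (\<Sum>N. (- (\<i> * of_real w)) ^ N * of_real (h $ N / pochhammer a N))"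

text \<open>The invariant of the induction over the factors. The coefficient bound provides absolute
  convergence and domination, the norm bound is the goal; in this form no measure has to be carried
  along.\<close>

definition mixture_coeffs :: "real \<Rightarrow> real fps \<Rightarrow> bool" where
  "mixture_coeffs a h \<longleftrightarrow>
     (\<forall>N. \<bar>h $ N\<bar> \<le> pochhammer a N / fact N) \<and> (\<forall>w. norm (mixture_series a h w) \<le> 1)"

text \<open>The point mass at \<open>c\<close>: the Pochhammer symbols cancel and the series is
  \<open>exp (- i w c)\<close>, of modulus 1.\<close>

lemma mixture_coeffs_linear:
  assumes a: "a > 0" and c: "\<bar>c\<bar> \<le> 1"
  shows "mixture_coeffs a (fps_rpow (1 - fps_const c * fps_X) (- a))"
proof -
  have pos: "pochhammer a N > 0" for N using a by (rule pochhammer_pos)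
  have "\<bar>fps_rpow (1 - fps_const c * fps_X) (- a) $ N\<bar> \<le> pochhammer a N / fact N" for N
  proof -
    have "\<bar>c\<bar> ^ N \<le> 1" using c by (simp add: power_le_one)
    then have "pochhammer a N / fact N * \<bar>c\<bar> ^ N \<le> pochhammer a N / fact N * 1"
      using pos[of N] by (intro mult_left_mono) auto
    then show ?thesis
      using pos[of N] by (simp add: fps_rpow_linear_nth abs_mult power_abs)
  qed
  moreover have "norm (mixture_series a (fps_rpow (1 - fps_const c * fps_X) (- a)) w) \<le> 1" for w
  proof -
    have "(- (\<i> * of_real w)) ^ N * of_real (fps_rpow (1 - fps_const c * fps_X) (- a) $ N / pochhammer a N)
       = (- (\<i> * of_real (w * c))) ^ N /\<^sub>R fact N" for N
    proof -
      have "fps_rpow (1 - fps_const c * fps_X) (- a) $ N / pochhammer a N = c ^ N / fact N"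
        using pos[of N] by (simp add: fps_rpow_linear_nth)
      moreover have "- (\<i> * complex_of_real (w * c)) = - (\<i> * of_real w) * of_real c" by simp
      ultimately show ?thesis
        by (simp only: power_mult_distrib) (simp add: scaleR_conv_of_real field_simps)
    qed
    then have "mixture_series a (fps_rpow (1 - fps_const c * fps_X) (- a)) w = exp (- (\<i> * of_real (w * c)))"
      unfolding mixture_series_def exp_def by simp
    then show ?thesis by (simp add: norm_exp_eq_Re)
  qed
  ultimately show ?thesis by (simp add: mixture_coeffs_def)
qed

text \<open>
  With \<open>p\<close> distributed as Beta(a, b), the series of the product at \<open>w\<close> is the expectation of the series of
  \<open>h\<close> at \<open>p w\<close> times \<open>exp (- i w c (1 - p))\<close>.
\<close>

lemma mixture_coeffs_mult_linear:
  assumes h: "mixture_coeffs a h" and a: "a > 0" and b: "b > 0" and c: "\<bar>c\<bar> \<le> 1"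
  shows "mixture_coeffs (a + b) (h * fps_rpow (1 - fps_const c * fps_X) (- b))"
proof -
  define h' where "h' = h * fps_rpow (1 - fps_const c * fps_X) (- b)"
  have h_le: "\<bar>h $ N\<bar> \<le> pochhammer a N / fact N" and F_le: "norm (mixture_series a h w) \<le> 1" for N w
    using h by (auto simp: mixture_coeffs_def)
  have posa: "pochhammer a N > 0" and posb: "pochhammer b N > 0"
    and posab: "pochhammer (a + b) N > 0" for N
    using a b by (auto intro!: pochhammer_pos)
  have h'_nth: "h' $ N = (\<Sum>m\<le>N. h $ m * (pochhammer b (N - m) / fact (N - m) * c ^ (N - m)))" for N
    by (simp add: h'_def fps_mult_nth fps_rpow_linear_nth atLeast0AtMost)
  have hq: "\<bar>h $ m / pochhammer a m\<bar> \<le> 1 / fact m" for m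
    using h_le[of m] posa[of m] by (simp add: abs_div divide_simps mult.commute)
  have cpow: "\<bar>c ^ k\<bar> \<le> 1" for k using c by (simp add: power_abs power_le_one)

  have "\<bar>h' $ N\<bar> \<le> pochhammer (a + b) N / fact N" for N
  proof -
    have "\<bar>h' $ N\<bar> \<le> (\<Sum>m\<le>N. (pochhammer a m / fact m) * (pochhammer b (N - m) / fact (N - m) * 1))"
      unfolding h'_nth
    proof (intro order.trans[OF sum_abs] sum_mono)
      fix m
      have "\<bar>pochhammer b (N - m) / fact (N - m) * c ^ (N - m)\<bar> \<le> pochhammer b (N - m) / fact (N - m) * 1"
        unfolding abs_mult using posb[of "N - m"] cpow[of "N - m"] by (intro mult_mono) auto
      then show "\<bar>h $ m * (pochhammer b (N - m) / fact (N - m) * c ^ (N - m))\<bar>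
          \<le> (pochhammer a m / fact m) * (pochhammer b (N - m) / fact (N - m) * 1)"
        unfolding abs_mult[of "h $ m"] using posa[of m] h_le[of m] by (intro mult_mono) auto
    qed
    \<comment> \<open>The Vandermonde convolution for rising factorials.\<close>
    also have "\<dots> = (\<Sum>m\<le>N. real (N choose m) * pochhammer a m * pochhammer b (N - m)) / fact N"
      unfolding sum_divide_distrib by (intro sum.cong) (auto simp: binomial_fact)
    finally show ?thesis by (simp add: pochhammer_binomial_sum)
  qed
  moreover have "norm (mixture_series (a + b) h' w) \<le> 1" for w
  proof -
    obtain M :: "real measure" where M: "finite_measure M" "sets M = sets borel"
      "AE p in M. 0 \<le> p \<and> p \<le> 1"
      "\<And>i j. (\<integral>p. p ^ i * (1 - p) ^ j \<partial>M) = pochhammer a i * pochhammer b j / pochhammer (a + b) (i + j)"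
      using beta_distribution_exists[OF a b] by blast
    interpret finite_measure M by (rule M(1))
    have meas: "borel_measurable M = (borel_measurable borel :: (real \<Rightarrow> real) set)"
      "borel_measurable M = (borel_measurable borel :: (real \<Rightarrow> complex) set)"
      by (rule measurable_cong_sets[OF M(2) refl])+
    have AE_M: "AE p in M. P p" if "\<And>p. 0 \<le> p \<Longrightarrow> p \<le> 1 \<Longrightarrow> P p" for P
      using M(3) by eventually_elim (use that in auto)
    have total: "measure M (space M) = 1" using M(4)[of 0 0] by simp
    define \<zeta> where "\<zeta> = - (\<i> * complex_of_real w)"
    have norm_\<zeta>: "norm \<zeta> = \<bar>w\<bar>" by (simp add: \<zeta>_def norm_mult)
    \<comment> \<open>The coefficient of \<open>(- i w)^N\<close> in the Cauchy product of the
      series of \<open>h\<close> at \<open>p w\<close> and of \<open>exp (- i w c (1 - p))\<close>.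
      Each summand integrates to a Beta moment, so that the integral of \<open>S N\<close> is the
      required coefficient.\<close>
    define S where "S = (\<lambda>N p. \<Sum>m\<le>N. (h $ m / pochhammer a m) * (c ^ (N - m) / fact (N - m)) *
        (p ^ m * (1 - p) ^ (N - m)) :: real)"
    define f where "f = (\<lambda>N p. \<zeta> ^ N * complex_of_real (S N p))"
    \<comment> \<open>The coefficient bounds leave the binomial expansion of
      \<open>(p + (1 - p)) ^ N\<close> over \<open>fact N\<close>. This majorant is independent of
      \<open>p\<close> and justifies exchanging sum and integral.\<close>
    have S_le: "\<bar>S N p\<bar> \<le> 1 / fact N" if p: "0 \<le> p" "p \<le> 1" for N p
    proof -
      have "\<bar>S N p\<bar> \<le> (\<Sum>m\<le>N. (1 / fact m) * (1 / fact (N - m)) * (p ^ m * (1 - p) ^ (N - m)))"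
        unfolding S_def
      proof (intro order.trans[OF sum_abs] sum_mono)
        fix m
        have "\<bar>c ^ (N - m) / fact (N - m)\<bar> \<le> 1 / fact (N - m)"
          using cpow[of "N - m"] by (simp add: divide_simps)
        then show "\<bar>(h $ m / pochhammer a m) * (c ^ (N - m) / fact (N - m)) * (p ^ m * (1 - p) ^ (N - m))\<bar>
           \<le> (1 / fact m) * (1 / fact (N - m)) * (p ^ m * (1 - p) ^ (N - m))"
          using hq[of m] p unfolding abs_mult[of _ "p ^ m * (1 - p) ^ (N - m)"]
            abs_mult[of "h $ m / pochhammer a m"]
          by (intro mult_mono) auto
      qed
      also have "\<dots> = (\<Sum>m\<le>N. real (N choose m) * p ^ m * (1 - p) ^ (N - m)) / fact N"
        unfolding sum_divide_distrib by (intro sum.cong) (auto simp: binomial_fact)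
      also have "(\<Sum>m\<le>N. real (N choose m) * p ^ m * (1 - p) ^ (N - m)) = (p + (1 - p)) ^ N"
        by (rule binomial_ring[symmetric])
      finally show ?thesis by simp
    qed
    have f_le: "norm (f N p) \<le> \<bar>w\<bar> ^ N / fact N" if p: "0 \<le> p" "p \<le> 1" for N p
      using mult_left_mono[OF S_le[OF p, of N], of "\<bar>w\<bar> ^ N"]
      by (simp add: f_def norm_mult norm_power norm_\<zeta>)
    have f_meas: "f N \<in> borel_measurable M" for N
      unfolding meas f_def S_def by (intro borel_measurable_continuous_onI continuous_intros)
    have f_int: "integrable M (f N)" for N
      by (rule integrable_const_bound[of _ "\<bar>w\<bar> ^ N / fact N"])
         (intro AE_M f_le f_meas; assumption)+
    have exp_sum: "summable (\<lambda>N. \<bar>w\<bar> ^ N / fact N)"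
      using summable_exp[of "\<bar>w\<bar>"] by (simp add: field_simps)
    have f_summable: "summable (\<lambda>N. norm (f N p))" if p: "0 \<le> p" "p \<le> 1" for p
      by (rule summable_comparison_test'[OF exp_sum, of 0]) (use f_le[OF p] in auto)
    have norm_int: "(\<integral>p. norm (f N p) \<partial>M) \<le> \<bar>w\<bar> ^ N / fact N" for N
    proof -
      have "(\<integral>p. norm (f N p) \<partial>M) \<le> (\<integral>p. \<bar>w\<bar> ^ N / fact N \<partial>M)"
        using f_int f_le by (intro integral_mono_AE AE_M) auto
      then show ?thesis by (simp add: total)
    qed
    have int_sum: "summable (\<lambda>N. \<integral>p. norm (f N p) \<partial>M)"
      by (rule summable_comparison_test'[OF exp_sum, of 0]) (use norm_int in auto)
    have AE_sum: "AE p in M. summable (\<lambda>N. norm (f N p))"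
      using f_summable by (intro AE_M)
    have S_int: "(\<integral>p. S N p \<partial>M) = h' $ N / pochhammer (a + b) N" for N
    proof -
      have i: "integrable M (\<lambda>p. p ^ m * (1 - p) ^ k)" for m k
      proof (rule integrable_const_bound[of _ 1])
        show "AE p in M. norm (p ^ m * (1 - p) ^ k) \<le> 1"
          by (intro AE_M) (auto simp: abs_mult intro!: mult_le_one power_le_one)
        show "(\<lambda>p. p ^ m * (1 - p) ^ k) \<in> borel_measurable M"
          unfolding meas by (intro borel_measurable_continuous_onI continuous_intros)
      qed
      have "(\<integral>p. S N p \<partial>M) = (\<Sum>m\<le>N. (h $ m / pochhammer a m) * (c ^ (N - m) / fact (N - m)) *
         (pochhammer a m * pochhammer b (N - m) / pochhammer (a + b) (m + (N - m))))"
        unfolding S_def using i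
        by (subst Bochner_Integration.integral_sum) (simp_all only: integral_mult_right_zero M(4) integrable_mult_right)
      also have "\<dots> = h' $ N / pochhammer (a + b) N"
        unfolding h'_nth sum_divide_distrib
        by (intro sum.cong refl) (use posa in \<open>auto simp: less_imp_neq[symmetric]\<close>)
      finally show ?thesis .
    qed
    have f_integral: "(\<integral>p. f N p \<partial>M) = \<zeta> ^ N * of_real (h' $ N / pochhammer (a + b) N)" for N
      unfolding f_def S_int[symmetric] by simp
    have f_suminf: "norm (\<Sum>N. f N p) \<le> 1" if p: "0 \<le> p" "p \<le> 1" for p
    proof -
      define A where "A = (\<lambda>m. (- (\<i> * of_real (p * w))) ^ m * complex_of_real (h $ m / pochhammer a m))"
      define B where "B = (\<lambda>m. (- (\<i> * complex_of_real (w * (c * (1 - p))))) ^ m /\<^sub>R fact m)"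
      have "f N p = (\<Sum>m\<le>N. A m * B (N - m))" for N
        unfolding f_def S_def of_real_sum sum_distrib_left
      proof (intro sum.cong refl)
        fix m assume "m \<in> {..N}"
        then have N: "\<zeta> ^ N = \<zeta> ^ m * \<zeta> ^ (N - m)" by (simp flip: power_add)
        have "A m = \<zeta> ^ m * of_real (p ^ m * (h $ m / pochhammer a m))"
        proof -
          have "- (\<i> * of_real (p * w)) = \<zeta> * of_real p" by (simp add: \<zeta>_def)
          then show ?thesis by (simp only: A_def power_mult_distrib) simp
        qed
        moreover have "B k = \<zeta> ^ k * of_real (c ^ k * (1 - p) ^ k / fact k)" for k
        proof -
          have "- (\<i> * of_real (w * (c * (1 - p)))) = \<zeta> * of_real (c * (1 - p))" by (simp add: \<zeta>_def)
          then show ?thesis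
            by (simp only: B_def power_mult_distrib) (simp add: power_mult_distrib scaleR_conv_of_real divide_inverse)
        qed
        ultimately show "\<zeta> ^ N * of_real (h $ m / pochhammer a m * (c ^ (N - m) / fact (N - m)) *
             (p ^ m * (1 - p) ^ (N - m))) = A m * B (N - m)"
          unfolding N by simp
      qed
      moreover have "(\<Sum>m. A m) * (\<Sum>m. B m) = (\<Sum>N. \<Sum>m\<le>N. A m * B (N - m))"
      proof (rule Cauchy_product)
        show "summable (\<lambda>m. norm (A m))"
        proof (rule summable_comparison_test'[OF summable_exp[of "\<bar>p * w\<bar>"], of 0])
          show "norm (norm (A m)) \<le> inverse (fact m) * \<bar>p * w\<bar> ^ m" for m
            using mult_left_mono[OF hq[of m], of "\<bar>p * w\<bar> ^ m"]
            by (simp add: A_def norm_mult norm_power divide_inverse mult.commute flip: of_real_divide of_real_mult)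
        qed
        show "summable (\<lambda>m. norm (B m))"
          unfolding B_def by (rule summable_norm_exp)
      qed
      moreover have "(\<Sum>m. A m) = mixture_series a h (p * w)"
        by (simp add: A_def mixture_series_def)
      moreover have "(\<Sum>m. B m) = exp (- (\<i> * of_real (w * (c * (1 - p)))))"
        by (simp add: B_def exp_def)
      ultimately have "(\<Sum>N. f N p) = mixture_series a h (p * w) * exp (- (\<i> * of_real (w * (c * (1 - p)))))"
        by simp
      then show ?thesis using F_le[of "p * w"] by (simp add: norm_mult norm_exp_eq_Re)
    qed
    have "mixture_series (a + b) h' w = (\<Sum>N. \<integral>p. f N p \<partial>M)"
      by (simp only: mixture_series_def f_integral \<zeta>_def)
    also have "\<dots> = (\<integral>p. (\<Sum>N. f N p) \<partial>M)"
      by (rule integral_suminf[symmetric, OF f_int AE_sum int_sum])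
    also have "norm \<dots> \<le> (\<integral>p. norm (\<Sum>N. f N p) \<partial>M)"
      by (rule integral_norm_bound)
    also have "\<dots> \<le> (\<integral>p. 1 \<partial>M)"
      using f_suminf integrable_suminf[OF f_int AE_sum int_sum]
      by (intro integral_mono_AE AE_M) auto
    also have "\<dots> = 1" by (simp add: total)
    finally show ?thesis .
  qed
  ultimately show ?thesis by (simp add: mixture_coeffs_def h'_def)
qed

text \<open>Builds the symmetric Dirichlet distribution one component at a time: the old components
  are scaled by \<open>p\<close> distributed as Beta(n \<lambda>, \<lambda>), and the new one
  receives \<open>1 - p\<close>.\<close>

lemma mixture_coeffs_prod:
  assumes lam: "lam > 0" and c: "\<And>k. \<bar>c k\<bar> \<le> 1" and n: "n > 0"
  shows "mixture_coeffs (real n * lam) (\<Prod>k<n. fps_rpow (1 - fps_const (c k) * fps_X) (- lam))"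
  using n
proof (induction n rule: nat_induct_non_zero)
  case 1
  show ?case using mixture_coeffs_linear[OF lam c] by simp
next
  case (Suc n)
  then show ?case
    using mixture_coeffs_mult_linear[OF Suc.IH _ lam c[of n]] lam by (simp add: algebra_simps)
qed

section \<open>Gegenbauer factors\<close>

text \<open>
  The factor \<open>(\<lambda> + j) / \<lambda> C\<^sub>j\<^sup>\<lambda>(\<xi>)\<close> with \<open>\<lambda>\<close> cancelled, so that it is a polynomial in \<open>\<lambda>\<close> and covers \<open>\<lambda> = 0\<close>.
\<close>

definition gegen_poly :: "real \<Rightarrow> nat \<Rightarrow> real \<Rightarrow> real" where
  "gegen_poly lam j \<xi> = (if j = 0 then 1 else (lam + real j) *
     (\<Sum>k\<le>j div 2. (-1) ^ k * pochhammer (lam + 1) (j - k - 1) / (fact k * fact (j - 2 * k)) * (2 * \<xi>) ^ (j - 2 * k)))"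

lemma gegen_poly_eq:
  assumes "lam \<noteq> 0"
  shows "(lam + real j) / lam * gegenbauer lam j \<xi> = gegen_poly lam j \<xi>"
proof (cases "j = 0")
  case True
  with assms show ?thesis by (simp add: gegen_poly_def gegenbauer_def)
next
  case False
  have "pochhammer lam (j - k) = lam * pochhammer (lam + 1) (j - k - 1)" if "k \<le> j div 2" for k
  proof -
    have "j - k = Suc (j - k - 1)" using that False by auto
    then show ?thesis by (metis pochhammer_rec)
  qed
  then have "gegenbauer lam j \<xi> = lam *
    (\<Sum>k\<le>j div 2. (-1) ^ k * pochhammer (lam + 1) (j - k - 1) / (fact k * fact (j - 2 * k)) * (2 * \<xi>) ^ (j - 2 * k))"
    unfolding gegenbauer_def sum_distrib_left by (intro sum.cong) auto
  with False assms show ?thesis by (simp add: gegen_poly_def)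
qed

lemma isCont_gegen_poly: "isCont (\<lambda>l. gegen_poly l j \<xi>) lam"
proof -
  have "continuous_on UNIV (\<lambda>l. gegen_poly l j \<xi>)"
    by (cases "j = 0") (auto simp: gegen_poly_def intro!: continuous_intros)
  then show ?thesis by (simp add: continuous_on_eq_continuous_at)
qed

text \<open>For \<open>lam = 0\<close> the \<open>Lim\<close> is the value at 0 of the continuous
  \<open>gegen_poly\<close>, which agrees with the quotient away from 0.\<close>

lemma gegen_factor_eq: "gegen_factor lam j \<xi> = gegen_poly lam j \<xi>"
proof (cases "lam = 0")
  case True
  have "((\<lambda>l. gegen_poly l j \<xi>) \<longlongrightarrow> gegen_poly 0 j \<xi>) (at 0)"
    using isCont_gegen_poly by (simp add: isCont_def)
  then have "((\<lambda>l. (l + real j) / l * gegenbauer l j \<xi>) \<longlongrightarrow> gegen_poly 0 j \<xi>) (at 0)"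
  proof (rule Lim_transform_eventually)
    show "\<forall>\<^sub>F l in at 0. gegen_poly l j \<xi> = (l + real j) / l * gegenbauer l j \<xi>"
      unfolding eventually_at_filter by (intro always_eventually allI impI gegen_poly_eq[symmetric])
  qed
  then have "Lim (at 0) (\<lambda>l. (l + real j) / l * gegenbauer l j \<xi>) = gegen_poly 0 j \<xi>"
    by (intro tendsto_Lim) auto
  with True show ?thesis by (simp add: gegen_factor_def)
next
  case False
  then show ?thesis using gegen_poly_eq[OF False] by (metis gegen_factor_def)
qed

lemma pochhammer_mono_base:
  fixes x y :: real
  assumes "0 \<le> x" "x \<le> y"
  shows "pochhammer x n \<le> pochhammer y n"
  unfolding pochhammer_prod using assms by (intro prod_mono) auto

text \<open>Geometric growth suffices, since the factorials in \<open>kernel_term\<close> dominate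
  it. The base 32 is \<open>2 * 2 * 8\<close>: \<open>2 ^ j\<close> each for \<open>lam + j\<close>
  and for the number of summands, and \<open>8 ^ j\<close> for Pochhammer symbol, binomial
  coefficient and power of \<open>2 * \<xi>\<close> together.\<close>

lemma gegen_poly_bound:
  assumes lam: "lam \<ge> 0" and \<xi>: "\<bar>\<xi>\<bar> \<le> 1"
  obtains D where "D \<ge> 0" "\<And>j. \<bar>gegen_poly lam j \<xi>\<bar> \<le> D * 32 ^ j"
proof -
  obtain L :: nat where L: "lam \<le> real L" using real_arch_simple by blast
  define D :: real where "D = (real L + 1) * fact L * 2 ^ L"
  have D1: "D \<ge> 1"
  proof -
    have "1 * 1 * 1 \<le> (real L + 1) * fact L * 2 ^ L"
      by (intro mult_mono mult_nonneg_nonneg) auto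
    then show ?thesis by (simp add: D_def)
  qed
  have poch: "pochhammer (lam + 1) q \<le> fact L * 2 ^ (L + q) * fact q" for q
  proof -
    have "pochhammer (lam + 1) q \<le> pochhammer (real L + 1) q"
      using lam L by (intro pochhammer_mono_base) auto
    also have "\<dots> = fact (L + q) / fact L"
      using pochhammer_product'[of "1::real" L q] by (simp add: pochhammer_fact[symmetric] add.commute)
    also have "\<dots> = real ((L + q) choose L) * fact q"
      by (simp add: binomial_fact)
    also have "\<dots> \<le> 2 ^ (L + q) * fact q"
      using binomial_le_pow2[of "L + q" L] by (intro mult_right_mono) (auto simp flip: of_nat_power)
    also have "\<dots> \<le> fact L * (2 ^ (L + q) * fact q)"
      using mult_right_mono[of 1 "fact L :: real" "2 ^ (L + q) * fact q"] by (simp add: fact_ge_1)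
    finally show ?thesis by simp
  qed
  have "\<bar>gegen_poly lam j \<xi>\<bar> \<le> D * 32 ^ j" for j
  proof (cases "j = 0")
    case True
    then show ?thesis using D1 by (simp add: gegen_poly_def)
  next
    case False
    have summand: "\<bar>(-1) ^ k * pochhammer (lam + 1) (j - k - 1) / (fact k * fact (j - 2 * k)) * (2 * \<xi>) ^ (j - 2 * k)\<bar>
       \<le> (fact L * 2 ^ L) * 8 ^ j" if k: "k \<le> j div 2" for k
    proof -
      have p0: "pochhammer (lam + 1) (j - k - 1) \<ge> 0"
        using lam by (intro pochhammer_nonneg) auto
      have "pochhammer (lam + 1) (j - k - 1) \<le> fact L * 2 ^ (L + (j - k - 1)) * fact (j - k - 1)"
        by (rule poch)
      also have "\<dots> \<le> fact L * 2 ^ (L + j) * fact (j - k)"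
        by (intro mult_mono mult_nonneg_nonneg power_increasing fact_mono) auto
      finally have "pochhammer (lam + 1) (j - k - 1) / (fact k * fact (j - 2 * k))
         \<le> fact L * 2 ^ (L + j) * fact (j - k) / (fact k * fact (j - 2 * k))"
        by (intro divide_right_mono) auto
      also have "\<dots> = fact L * 2 ^ (L + j) * real (j - k choose k)"
      proof -
        have "k \<le> j - k" "j - k - k = j - 2 * k" using k by auto
        then have "real (j - k choose k) = fact (j - k) / (fact k * fact (j - 2 * k))"
          using binomial_fact[of k "j - k", where ?'a = real] by metis
        then show ?thesis by simp
      qed
      also have "\<dots> \<le> fact L * 2 ^ (L + j) * 2 ^ j"
      proof (intro mult_left_mono)
        have "(j - k choose k) \<le> 2 ^ j"
          by (rule order.trans[OF binomial_le_pow2]) (simp add: power_increasing)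
        then show "real (j - k choose k) \<le> 2 ^ j" by (simp flip: of_nat_power)
      qed auto
      finally have q: "pochhammer (lam + 1) (j - k - 1) / (fact k * fact (j - 2 * k)) \<le> fact L * 2 ^ (L + j) * 2 ^ j" .
      have "\<bar>(2 * \<xi>) ^ (j - 2 * k)\<bar> \<le> 2 ^ (j - 2 * k)"
        unfolding power_abs using \<xi> by (intro power_mono) auto
      also have "\<dots> \<le> 2 ^ j" by (intro power_increasing) auto
      finally have x: "\<bar>(2 * \<xi>) ^ (j - 2 * k)\<bar> \<le> 2 ^ j" .
      have "\<bar>(-1) ^ k * pochhammer (lam + 1) (j - k - 1) / (fact k * fact (j - 2 * k)) * (2 * \<xi>) ^ (j - 2 * k)\<bar>
        = (pochhammer (lam + 1) (j - k - 1) / (fact k * fact (j - 2 * k))) * \<bar>(2 * \<xi>) ^ (j - 2 * k)\<bar>"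
        using p0 by (simp add: abs_mult)
      also have "\<dots> \<le> (fact L * 2 ^ (L + j) * 2 ^ j) * 2 ^ j"
        using q x p0 by (intro mult_mono) auto
      also have "\<dots> = (fact L * 2 ^ L) * (2 * 2 * 2) ^ j"
        by (simp only: power_add power_mult_distrib mult_ac)
      finally show ?thesis by simp
    qed
    have "\<bar>gegen_poly lam j \<xi>\<bar> \<le> (lam + real j) * (\<Sum>k\<le>j div 2. (fact L * 2 ^ L) * 8 ^ j)"
      unfolding gegen_poly_def using False lam
      by (simp only: if_False abs_mult)
         (intro mult_mono order.trans[OF sum_abs] sum_mono summand, auto)
    also have "\<dots> = (lam + real j) * (real (Suc (j div 2)) * ((fact L * 2 ^ L) * 8 ^ j))"
      by simp
    also have "\<dots> \<le> ((real L + 1) * 2 ^ j) * (2 ^ j * ((fact L * 2 ^ L) * 8 ^ j))"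
    proof (intro mult_mono mult_nonneg_nonneg)
      have j: "real j + 1 \<le> 2 ^ j"
        using of_nat_mono[of "Suc j" "2 ^ j", where ?'a = real] by (simp add: Suc_leI)
      then have "(real L + 1) * (real j + 1) \<le> (real L + 1) * 2 ^ j"
        by (intro mult_left_mono) auto
      then show "lam + real j \<le> (real L + 1) * 2 ^ j"
        using L zero_le_mult_iff[of "real L" "real j"] of_nat_0_le_iff
        unfolding ring_distribs by (smt (verit))
      show "real (Suc (j div 2)) \<le> 2 ^ j"
      proof -
        have "real (j div 2) \<le> real j" by simp
        with j show ?thesis by simp
      qed
    qed (use lam in auto)
    also have "\<dots> = D * (2 * 2 * 8) ^ j"
      by (simp only: D_def power_mult_distrib mult_ac)
    finally show ?thesis by simp
  qed
  with D1 show ?thesis by (intro that[of D]) auto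
qed

section \<open>The power series of the kernel\<close>

text \<open>The coefficient of \<open>(- i w)^N\<close> in the kernel. Through
  \<open>gegen_poly\<close> it stays meaningful and continuous at \<open>lam = 0\<close>.\<close>

definition kernel_coeff :: "nat \<Rightarrow> real \<Rightarrow> real \<Rightarrow> nat \<Rightarrow> real" where
  "kernel_coeff n lam \<xi> N = (\<Sum>(j, k)\<in>weighted_pairs n N.
     gegen_poly lam j \<xi> / (2 ^ N * (fact k * pochhammer (real n * lam + 1) (k + n * j))))"

text \<open>By \<open>ballot_eq_pochhammer\<close> each summand is a ballot number times a
  Gegenbauer polynomial, over \<open>2 ^ N\<close> and a Pochhammer symbol depending only on
  \<open>N\<close>. The sum is then \<open>gegenbauer_ballot_transform\<close>, whose
  \<open>2 ^ N\<close> cancels.\<close>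

lemma kernel_coeff_eq:
  assumes n: "n > 0" and lam: "lam > 0"
  shows "kernel_coeff n lam (cos \<theta>) N
    = (\<Prod>k<n. fps_rpow (1 - fps_const (cos ((\<theta> + 2 * pi * real k) / real n)) * fps_X) (- lam)) $ N
      / pochhammer (real n * lam) N"
proof -
  let ?\<alpha> = "real n * lam"
  have \<alpha>: "?\<alpha> > 0" using n lam by simp
  then have pos: "pochhammer ?\<alpha> N > 0" by (rule pochhammer_pos)
  have "gegen_poly lam j (cos \<theta>) / (2 ^ N * (fact k * pochhammer (?\<alpha> + 1) (k + n * j)))
     = ballot (?\<alpha> + real (n * j)) k * gegenbauer lam j (cos \<theta>) / (2 ^ N * pochhammer ?\<alpha> N)"
    if "(j, k) \<in> weighted_pairs n N" for j k
  proof -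
    have N: "n * j + 2 * k = N" using that by (simp add: weighted_pairs_def)
    have "(?\<alpha> + real (n * j)) / ?\<alpha> = (lam + real j) / lam"
      using n lam by (simp add: divide_simps) (simp add: algebra_simps)
    then have "ballot (?\<alpha> + real (n * j)) k
        = pochhammer ?\<alpha> N * ((lam + real j) / lam) / (fact k * pochhammer (?\<alpha> + 1) (k + n * j))"
      using ballot_eq_pochhammer[OF \<alpha>, of "n * j" k] N by simp
    then show ?thesis
      using pos gegen_poly_eq[of lam j "cos \<theta>", symmetric] lam by simp
  qed
  then have "kernel_coeff n lam (cos \<theta>) N
     = (\<Sum>(j, k)\<in>weighted_pairs n N. ballot (?\<alpha> + real (n * j)) k * gegenbauer lam j (cos \<theta>)) / (2 ^ N * pochhammer ?\<alpha> N)"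
    unfolding kernel_coeff_def sum_divide_distrib by (intro sum.cong) auto
  then show ?thesis by (simp only: gegenbauer_ballot_transform[OF n]) simp
qed

lemma kernel_coeff_bounds_pos:
  assumes n: "n > 0" and lam: "lam > 0"
  shows "\<bar>kernel_coeff n lam (cos \<theta>) N\<bar> \<le> 1 / fact N"
    and "norm (\<Sum>N. (- (\<i> * of_real w)) ^ N * of_real (kernel_coeff n lam (cos \<theta>) N)) \<le> 1"
proof -
  define h where "h = (\<Prod>k<n. fps_rpow (1 - fps_const (cos ((\<theta> + 2 * pi * real k) / real n)) * fps_X) (- lam))"
  have h: "mixture_coeffs (real n * lam) h"
    unfolding h_def using n lam by (intro mixture_coeffs_prod) auto
  have pos: "pochhammer (real n * lam) N > 0" using n lam by (intro pochhammer_pos) simp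
  have e: "kernel_coeff n lam (cos \<theta>) N = h $ N / pochhammer (real n * lam) N" for N
    unfolding h_def by (rule kernel_coeff_eq[OF n lam])
  have "\<bar>h $ N\<bar> \<le> pochhammer (real n * lam) N / fact N"
    using h by (simp add: mixture_coeffs_def)
  then show "\<bar>kernel_coeff n lam (cos \<theta>) N\<bar> \<le> 1 / fact N"
    unfolding e using pos by (simp add: abs_div divide_simps mult.commute)
  show "norm (\<Sum>N. (- (\<i> * of_real w)) ^ N * of_real (kernel_coeff n lam (cos \<theta>) N)) \<le> 1"
    unfolding e using h by (simp add: mixture_coeffs_def mixture_series_def)
qed

lemma isCont_kernel_coeff: "isCont (\<lambda>l. kernel_coeff n l \<xi> N) 0"
proof -
  have "isCont (\<lambda>l. pochhammer (real n * l + 1) q) 0" for q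
  proof -
    have "continuous_on UNIV (\<lambda>l. pochhammer (real n * l + 1 :: real) q)"
      by (intro continuous_intros)
    then show ?thesis by (simp add: continuous_on_eq_continuous_at)
  qed
  moreover have "pochhammer (1::real) q \<noteq> 0" for q by (simp flip: pochhammer_fact)
  ultimately show ?thesis
    unfolding kernel_coeff_def case_prod_beta
    by (intro continuous_intros isCont_gegen_poly) (auto simp: case_prod_beta)
qed

text \<open>For \<open>lam = 0\<close> the bound passes to the limit from the right. Tannery's
  theorem applies because the coefficient bound \<open>1 / fact N\<close> is uniform in
  \<open>lam > 0\<close>.\<close>

lemma norm_kernel_series_le_1:
  assumes n: "n > 0" and lam: "lam \<ge> 0"
  shows "norm (\<Sum>N. (- (\<i> * of_real w)) ^ N * of_real (kernel_coeff n lam (cos \<theta>) N)) \<le> 1"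
proof (cases "lam = 0")
  case False
  with lam kernel_coeff_bounds_pos(2)[OF n] show ?thesis by simp
next
  case True
  let ?a = "\<lambda>N l. (- (\<i> * of_real w)) ^ N * complex_of_real (kernel_coeff n l (cos \<theta>) N)"
  have pos: "\<forall>\<^sub>F l in at_right (0::real). l > 0" by (simp add: eventually_at_right_less)
  have "((\<lambda>l. \<Sum>N. ?a N l) \<longlongrightarrow> (\<Sum>N. ?a N 0)) (at_right 0)"
  proof (rule tannerys_theorem[THEN conjunct2, THEN conjunct2])
    show "((\<lambda>l. ?a N l) \<longlongrightarrow> ?a N 0) (at_right 0)" for N
    proof -
      have "((\<lambda>l. kernel_coeff n l (cos \<theta>) N) \<longlongrightarrow> kernel_coeff n 0 (cos \<theta>) N) (at_right 0)"
        using isCont_kernel_coeff[of n "cos \<theta>" N]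
        by (auto simp: isCont_def intro: tendsto_within_subset)
      then show ?thesis by (intro tendsto_intros)
    qed
    show "\<forall>\<^sub>F (N, l) in sequentially \<times>\<^sub>F at_right 0. norm (?a N l) \<le> \<bar>w\<bar> ^ N / fact N"
    proof -
      have "norm (?a N l) \<le> \<bar>w\<bar> ^ N / fact N" if "l > 0" for N l
        using mult_left_mono[OF kernel_coeff_bounds_pos(1)[OF n that, of \<theta> N], of "\<bar>w\<bar> ^ N"]
        by (simp add: norm_mult norm_power)
      then have "\<forall>\<^sub>F p in sequentially \<times>\<^sub>F at_right 0. norm (?a (fst p) (snd p)) \<le> \<bar>w\<bar> ^ fst p / fact (fst p)"
        by (intro eventually_mono[OF eventually_prodI[OF always_eventually pos, of "\<lambda>_. True"]]) auto
      then show ?thesis unfolding case_prod_beta .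
    qed
    show "summable (\<lambda>N. \<bar>w\<bar> ^ N / fact N)"
      using summable_exp[of "\<bar>w\<bar>"] by (simp add: field_simps)
  qed auto
  then have "((\<lambda>l. norm (\<Sum>N. ?a N l)) \<longlongrightarrow> norm (\<Sum>N. ?a N 0)) (at_right 0)"
    by (rule tendsto_norm)
  moreover have "\<forall>\<^sub>F l in at_right 0. norm (\<Sum>N. ?a N l) \<le> 1"
    using pos by eventually_elim (rule kernel_coeff_bounds_pos(2)[OF n])
  ultimately have "norm (\<Sum>N. ?a N 0) \<le> 1"
    by (intro tendsto_upperbound[of _ _ "at_right 0"]) auto
  with True show ?thesis by simp
qed

section \<open>Absolute convergence and regrouping of the double series over
  \<open>(j, k)\<close>\<close>

lemma suminf_regroup:
  fixes T :: "nat \<times> nat \<Rightarrow> complex"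
  assumes n: "n > 0" and T: "(\<lambda>p. norm (T p)) summable_on UNIV"
  shows "summable (\<lambda>j. \<Sum>k. T (j, k))"
    "(\<Sum>j. \<Sum>k. T (j, k)) = (\<Sum>N. \<Sum>p\<in>weighted_pairs n N. T p)"
proof -
  have "T summable_on UNIV" using T by (rule Infinite_Sum.abs_summable_summable)
  then obtain S where S: "(T has_sum S) UNIV" by (auto simp: summable_on_def)
  have abs_row: "(\<lambda>k. norm (T (j, k))) summable_on UNIV" for j
    using T Infinite_Sum.abs_summable_on_Sigma_iff[of T UNIV "\<lambda>_. UNIV"] by simp
  have row: "((\<lambda>k. T (j, k)) has_sum (\<Sum>k. T (j, k))) UNIV" for j
  proof -
    have "summable (\<lambda>k. norm (T (j, k)))" using abs_row by (rule summable_on_imp_summable)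
    then show ?thesis
      by (intro norm_summable_imp_has_sum summable_sums) (auto intro: summable_norm_cancel)
  qed
  have "((\<lambda>j. \<Sum>k. T (j, k)) has_sum S) UNIV"
    by (rule has_sum_SigmaD[where f = T and A = UNIV and B = "\<lambda>_. UNIV"]) (use S row in auto)
  then have rows: "(\<lambda>j. \<Sum>k. T (j, k)) sums S" by (rule has_sum_imp_sums)
  then show "summable (\<lambda>j. \<Sum>k. T (j, k))" by (rule sums_summable)
  \<comment> \<open>The sum \<open>S\<close>, already evaluated by rows, is now evaluated by degree:
    each pair lies in exactly one \<open>weighted_pairs n N\<close>, with
    \<open>N = n * j + 2 * k\<close>.\<close>
  have "((\<lambda>q. T (snd q)) has_sum S) (Sigma UNIV (weighted_pairs n))"
    by (subst has_sum_reindex_bij_witness[of _ "\<lambda>p. (n * fst p + 2 * snd p, p)" snd UNIV T _ S])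
       (use S in \<open>auto simp: weighted_pairs_def\<close>)
  then have "((\<lambda>N. \<Sum>p\<in>weighted_pairs n N. T p) has_sum S) UNIV"
    by (rule has_sum_SigmaD) (auto intro!: has_sum_finiteI finite_weighted_pairs[OF n])
  then have "(\<lambda>N. \<Sum>p\<in>weighted_pairs n N. T p) sums S" by (rule has_sum_imp_sums)
  with rows show "(\<Sum>j. \<Sum>k. T (j, k)) = (\<Sum>N. \<Sum>p\<in>weighted_pairs n N. T p)"
    by (metis sums_unique)
qed

lemma summable_on_prod_nonneg:
  fixes u v :: "nat \<Rightarrow> real"
  assumes "summable u" "summable v" "\<And>j. u j \<ge> 0" "\<And>k. v k \<ge> 0"
  shows "(\<lambda>(j, k). u j * v k) summable_on UNIV"
proof -
  have "(v has_sum suminf v) UNIV"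
    using assms by (intro norm_summable_imp_has_sum) auto
  moreover have "u summable_on UNIV"
    using assms by (simp add: summable_on_UNIV_nonneg_real_iff)
  ultimately have "(\<lambda>(j, k). u j * v k) summable_on Sigma UNIV (\<lambda>_. UNIV)"
    using assms
    by (intro summable_on_SigmaI[where g = "\<lambda>j. u j * suminf v"])
       (auto intro: has_sum_cmult_right summable_on_cmult_left)
  then show ?thesis by simp
qed

definition kernel_term :: "nat \<Rightarrow> real \<Rightarrow> real \<Rightarrow> real \<Rightarrow> nat \<times> nat \<Rightarrow> complex" where
  "kernel_term n lam \<xi> w = (\<lambda>(j, k). (- (\<i> * of_real w)) ^ (n * j + 2 * k) *
     of_real (gegen_poly lam j \<xi> / (2 ^ (n * j + 2 * k) * (fact k * pochhammer (real n * lam + 1) (k + n * j)))))"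

text \<open>The Pochhammer symbol is at least \<open>fact (k + n * j)\<close>, hence at least
  \<open>fact j\<close>, which absorbs the \<open>32 ^ j\<close> of \<open>gegen_poly_bound\<close>.
  The majorant then splits into a function of \<open>j\<close> times a function of
  \<open>k\<close>.\<close>

lemma kernel_term_abs_summable:
  assumes n: "n > 0" and lam: "lam \<ge> 0" and \<xi>: "\<bar>\<xi>\<bar> \<le> 1"
  shows "(\<lambda>p. norm (kernel_term n lam \<xi> w p)) summable_on UNIV"
proof -
  obtain D where D: "D \<ge> 0" "\<And>j. \<bar>gegen_poly lam j \<xi>\<bar> \<le> D * 32 ^ j"
    using gegen_poly_bound[OF lam \<xi>] by blast
  define x where "x = \<bar>w\<bar> / 2"
  have x0: "x \<ge> 0" by (simp add: x_def)
  define u where "u = (\<lambda>j. D * ((32 * x ^ n) ^ j / fact j))"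
  define v where "v = (\<lambda>k. (x ^ 2) ^ k / fact k)"
  have exps: "summable (\<lambda>k. y ^ k / fact k :: real)" for y
    using summable_exp[of y] by (simp add: field_simps)
  show ?thesis
  proof (rule Infinite_Sum.abs_summable_on_comparison_test')
    show "(\<lambda>(j, k). u j * v k) summable_on UNIV"
      using D x0 unfolding u_def v_def
      by (intro summable_on_prod_nonneg summable_mult exps) auto
    fix p :: "nat \<times> nat"
    obtain j k where p: "p = (j, k)" by fastforce
    let ?q = "pochhammer (real n * lam + 1) (k + n * j)"
    have "fact j \<le> (fact (k + n * j) :: real)"
      using n by (intro fact_mono) (simp add: trans_le_add2)
    also have "\<dots> = pochhammer 1 (k + n * j)" by (simp add: pochhammer_fact)
    also have "\<dots> \<le> ?q" using lam by (intro pochhammer_mono_base) auto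
    finally have q: "fact j \<le> ?q" .
    have q0: "?q > 0" using lam by (intro pochhammer_pos) (simp add: add_nonneg_pos)
    have "norm (kernel_term n lam \<xi> w p) = x ^ (n * j + 2 * k) * (\<bar>gegen_poly lam j \<xi>\<bar> / (fact k * ?q))"
      using q0
      by (simp only: p kernel_term_def prod.case norm_mult norm_power norm_of_real norm_minus_cancel norm_ii mult_1_left)
         (simp add: x_def power_divide abs_mult)
    also have "\<dots> \<le> x ^ (n * j + 2 * k) * (D * 32 ^ j / (fact k * fact j))"
      using x0 D q by (intro mult_left_mono frac_le mult_mono) auto
    also have "\<dots> = u j * v k"
      by (simp add: u_def v_def power_add power_mult power_mult_distrib) (simp add: mult_ac)
    finally show "norm (kernel_term n lam \<xi> w p) \<le> (case p of (j, k) \<Rightarrow> u j * v k)"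
      by (simp add: p)
  qed
qed

lemma kernel_term_sum_weighted_pairs:
  "(\<Sum>p\<in>weighted_pairs n N. kernel_term n lam \<xi> w p) = (- (\<i> * of_real w)) ^ N * of_real (kernel_coeff n lam \<xi> N)"
  unfolding kernel_coeff_def of_real_sum sum_distrib_left
  by (intro sum.cong refl) (auto simp: kernel_term_def weighted_pairs_def)

text \<open>Writing the order as \<open>i + \<alpha>\<close> isolates a prefactor that depends only
  on \<open>\<alpha>\<close> and \<open>w\<close>. With \<open>i = n * j\<close> it is common to all
  rows of the kernel, and only natural powers remain in the series.\<close>

lemma bessel_J_series:
  assumes w: "w > 0" and \<alpha>: "\<alpha> \<ge> 0"
  shows "summable (\<lambda>k. (-1) ^ k * (w / 2) ^ (i + 2 * k) / (fact k * pochhammer (\<alpha> + 1) (k + i)))"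
    and "bessel_J (real i + \<alpha>) w = (w / 2) powr \<alpha> / Gamma (\<alpha> + 1) *
      (\<Sum>k. (-1) ^ k * (w / 2) ^ (i + 2 * k) / (fact k * pochhammer (\<alpha> + 1) (k + i)))"
proof -
  let ?g = "\<lambda>k. (-1) ^ k * (w / 2) ^ (i + 2 * k) / (fact k * pochhammer (\<alpha> + 1) (k + i))"
  show sm: "summable ?g"
  proof (rule summable_comparison_test'[of "\<lambda>k. (w / 2) ^ i * (inverse (fact k) * ((w / 2)\<^sup>2) ^ k)" 0])
    show "summable (\<lambda>k. (w / 2) ^ i * (inverse (fact k) * ((w / 2)\<^sup>2) ^ k))"
      by (intro summable_mult summable_exp)
    fix k
    have "(1::real) \<le> fact (k + i)" by (rule fact_ge_1)
    also have "\<dots> = pochhammer 1 (k + i)" by (simp add: pochhammer_fact)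
    also have "\<dots> \<le> pochhammer (\<alpha> + 1) (k + i)" using \<alpha> by (intro pochhammer_mono_base) auto
    finally have q: "1 \<le> pochhammer (\<alpha> + 1) (k + i)" .
    have "norm (?g k) = (w / 2) ^ (i + 2 * k) / (fact k * pochhammer (\<alpha> + 1) (k + i))"
      using w q by (simp add: abs_mult)
    also have "\<dots> \<le> (w / 2) ^ (i + 2 * k) / (fact k * 1)"
      using w q by (intro divide_left_mono mult_left_mono mult_pos_pos) auto
    also have "\<dots> = (w / 2) ^ i * (inverse (fact k) * ((w / 2)\<^sup>2) ^ k)"
      unfolding power_add power_mult[of "w / 2" 2 k] by (simp only: divide_inverse mult_1_left mult_1_right mult_ac)
    finally show "norm (?g k) \<le> (w / 2) ^ i * (inverse (fact k) * ((w / 2)\<^sup>2) ^ k)" .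
  qed
  have "(-1) ^ k / (fact k * Gamma (real k + (real i + \<alpha>) + 1)) * (w / 2) powr (2 * real k + (real i + \<alpha>))
     = (w / 2) powr \<alpha> / Gamma (\<alpha> + 1) * ?g k" for k
  proof -
    have "Gamma (\<alpha> + 1) > 0" using \<alpha> by (intro Gamma_real_pos) auto
    moreover have "\<alpha> + 1 \<notin> \<int>\<^sub>\<le>\<^sub>0" using \<alpha> by (auto elim!: nonpos_Ints_cases)
    moreover have "real k + (real i + \<alpha>) + 1 = \<alpha> + 1 + real (k + i)" by simp
    ultimately have G: "Gamma (real k + (real i + \<alpha>) + 1) = pochhammer (\<alpha> + 1) (k + i) * Gamma (\<alpha> + 1)"
      by (simp add: pochhammer_Gamma add_ac)
    have "2 * real k + (real i + \<alpha>) = real (i + 2 * k) + \<alpha>" by simp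
    then have "(w / 2) powr (2 * real k + (real i + \<alpha>)) = (w / 2) ^ (i + 2 * k) * (w / 2) powr \<alpha>"
      using w by (simp only: powr_add) (subst powr_realpow, auto)
    then show ?thesis unfolding G by (simp add: mult_ac)
  qed
  then show "bessel_J (real i + \<alpha>) w = (w / 2) powr \<alpha> / Gamma (\<alpha> + 1) * (\<Sum>k. ?g k)"
    by (simp only: bessel_J_def suminf_mult[OF sm])
qed

text \<open>For \<open>a = 2 / n\<close> the phase of the \<open>j\<close>-th term of the kernel is
  the case \<open>N = n * j\<close>.\<close>

lemma exp_minus_ii_half_pi: "exp (- (\<i> * of_real (pi * real N / 2))) = (- \<i>) ^ N"
proof -
  have "exp (- (\<i> * of_real (pi * real N / 2))) = exp (of_nat N * (- (\<i> * of_real (pi / 2))))"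
    by (simp add: mult_ac)
  also have "\<dots> = exp (- (\<i> * of_real (pi / 2))) ^ N" by (rule exp_of_nat_mult)
  also have "exp (- (\<i> * of_real (pi / 2))) = - \<i>"
  proof -
    have "exp (- (\<i> * of_real (pi / 2))) = cis (- (pi / 2))" by (simp add: cis_conv_exp)
    then show ?thesis by (simp add: complex_eq_iff)
  qed
  finally show ?thesis .
qed

text \<open>For \<open>a = 2 / n\<close> the Bessel orders are \<open>n j + n \<lambda>\<close> and
  their argument is \<open>w\<close>. The normalization of the kernel cancels the common prefactor,
  leaving a double power series to be regrouped by degree.\<close>

lemma gen_fourier_kernel_eq_series:
  fixes x y :: "'a::euclidean_space"
  assumes n: "n > 0" and m: "DIM('a) \<ge> 2" and x: "x \<noteq> 0" and y: "y \<noteq> 0"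
  defines "lam \<equiv> (real DIM('a) - 2) / 2" and "\<xi> \<equiv> (x \<bullet> y) / (norm x * norm y)"
    and "w \<equiv> real n * (norm x * norm y) powr (1 / real n)"
  shows "gen_fourier_kernel (2 / real n) x y
    = (\<Sum>N. (- (\<i> * of_real w)) ^ N * of_real (kernel_coeff n lam \<xi> N))"
proof -
  define z where "z = norm x * norm y"
  define \<alpha> where "\<alpha> = real n * lam"
  define c0 where "c0 = (2 / real n) powr \<alpha> * Gamma (\<alpha> + 1)"
  have z: "z > 0" using x y by (simp add: z_def)
  have lam: "lam \<ge> 0" using m by (simp add: lam_def)
  then have \<alpha>: "\<alpha> \<ge> 0" by (simp add: \<alpha>_def)
  have w_def': "w = real n * z powr (1 / real n)" by (simp add: w_def z_def)
  have w: "w > 0" using n z by (simp add: w_def')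
  have \<xi>: "\<bar>\<xi>\<bar> \<le> 1"
    using Cauchy_Schwarz_ineq2[of x y] z by (simp add: \<xi>_def z_def[symmetric] abs_div divide_simps)
  have G: "Gamma (\<alpha> + 1) > 0" using \<alpha> by (intro Gamma_real_pos) auto
  have c0: "c0 > 0" using G n by (simp add: c0_def)
  \<comment> \<open>Since \<open>w / 2\<close> is \<open>n / 2\<close> times
    \<open>z powr (1 / n)\<close>, its power \<open>\<alpha> = n \<lambda>\<close> produces exactly
    \<open>z powr lam\<close>.\<close>
  have scale: "c0 * (z powr (- lam) * ((w / 2) powr \<alpha> / Gamma (\<alpha> + 1))) = 1"
  proof -
    have "(w / 2) powr \<alpha> = (real n / 2) powr \<alpha> * z powr lam"
    proof -
      have "w / 2 = real n / 2 * z powr (1 / real n)" by (simp add: w_def')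
      then have "(w / 2) powr \<alpha> = (real n / 2) powr \<alpha> * z powr (1 / real n * \<alpha>)"
        using n z by (simp only: powr_mult powr_powr)
      moreover have "1 / real n * \<alpha> = lam" using n by (simp add: \<alpha>_def)
      ultimately show ?thesis by simp
    qed
    moreover have "(2 / real n) powr \<alpha> * (real n / 2) powr \<alpha> = 1"
      using n by (simp flip: powr_mult)
    moreover have "z powr (- lam) * z powr lam = 1"
      using z by (simp flip: powr_add)
    ultimately show ?thesis using G by (simp add: c0_def) algebra
  qed
  define T where "T = kernel_term n lam \<xi> w"
  have T: "(\<lambda>p. norm (T p)) summable_on UNIV"
    unfolding T_def by (rule kernel_term_abs_summable[OF n lam \<xi>])
  have row: "exp (- (\<i> * complex_of_real (pi * real j / (2 / real n)))) *
      complex_of_real (gegen_factor lam j \<xi> * z powr (- lam) *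
        bessel_J (2 * (real j + lam) / (2 / real n)) ((2 / (2 / real n)) * z powr ((2 / real n) / 2)))
    = of_real (1 / c0) * (\<Sum>k. T (j, k))" for j
  proof -
    let ?g = "\<lambda>k. (-1) ^ k * (w / 2) ^ (n * j + 2 * k) / (fact k * pochhammer (\<alpha> + 1) (k + n * j))"
    have g: "summable ?g" by (rule bessel_J_series(1)[OF w \<alpha>])
    have "2 * (real j + lam) / (2 / real n) = real (n * j) + \<alpha>"
      using n by (simp add: \<alpha>_def algebra_simps)
    moreover have "(2 / (2 / real n)) * z powr ((2 / real n) / 2) = w"
      using n by (simp add: w_def')
    moreover have "exp (- (\<i> * complex_of_real (pi * real j / (2 / real n)))) = (- \<i>) ^ (n * j)"
      using exp_minus_ii_half_pi[of "n * j"] by (simp add: mult_ac)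
    moreover have "z powr (- lam) * bessel_J (real (n * j) + \<alpha>) w = 1 / c0 * (\<Sum>k. ?g k)"
    proof -
      have "z powr (- lam) * ((w / 2) powr \<alpha> / Gamma (\<alpha> + 1)) = 1 / c0"
        using scale c0 by (metis nonzero_eq_divide_eq mult.commute less_irrefl)
      then show ?thesis by (simp only: bessel_J_series(2)[OF w \<alpha>] mult.assoc[symmetric])
    qed
    ultimately have "exp (- (\<i> * complex_of_real (pi * real j / (2 / real n)))) *
      complex_of_real (gegen_factor lam j \<xi> * z powr (- lam) *
        bessel_J (2 * (real j + lam) / (2 / real n)) ((2 / (2 / real n)) * z powr ((2 / real n) / 2)))
      = (- \<i>) ^ (n * j) * of_real (gegen_poly lam j \<xi> * (1 / c0 * (\<Sum>k. ?g k)))"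
      by (simp only: gegen_factor_eq mult.assoc)
    also have "\<dots> = of_real (1 / c0) * ((- \<i>) ^ (n * j) * of_real (gegen_poly lam j \<xi>) * of_real (\<Sum>k. ?g k))"
      by simp
    also have "of_real (\<Sum>k. ?g k) = (\<Sum>k. complex_of_real (?g k))"
      by (rule suminf_of_real[OF g])
    also have "(- \<i>) ^ (n * j) * of_real (gegen_poly lam j \<xi>) * (\<Sum>k. complex_of_real (?g k))
       = (\<Sum>k. (- \<i>) ^ (n * j) * of_real (gegen_poly lam j \<xi>) * complex_of_real (?g k))"
      by (rule suminf_mult[symmetric]) (use g in \<open>simp only: summable_of_real\<close>)
    also have "\<dots> = (\<Sum>k. T (j, k))"
    proof (intro suminf_cong)
      fix k
      \<comment> \<open>The phase supplies \<open>(- \<i>) ^ (n * j)\<close>, and the alternating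
        sign of the Bessel series is \<open>(- \<i>) ^ (2 * k)\<close>.\<close>
      have "(- (\<i> * complex_of_real w)) ^ (n * j + 2 * k) = (- \<i>) ^ (n * j) * (- 1) ^ k * of_real w ^ (n * j + 2 * k)"
      proof -
        have "(- (\<i> * complex_of_real w)) ^ (n * j + 2 * k) = (- \<i>) ^ (n * j + 2 * k) * of_real w ^ (n * j + 2 * k)"
          by (simp only: mult_minus_left[symmetric] power_mult_distrib)
        also have "(- \<i>) ^ (n * j + 2 * k) = (- \<i>) ^ (n * j) * ((- \<i>)\<^sup>2) ^ k"
          by (simp only: power_add power_mult)
        finally show ?thesis by simp
      qed
      then show "(- \<i>) ^ (n * j) * of_real (gegen_poly lam j \<xi>) * complex_of_real (?g k) = T (j, k)"
        by (simp add: T_def kernel_term_def \<alpha>_def power_divide)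
    qed
    finally show ?thesis .
  qed
  have c: "(2 / real n) powr (2 * lam / (2 / real n)) * Gamma ((2 * lam + 2 / real n) / (2 / real n)) = c0"
  proof -
    have "2 * lam / (2 / real n) = \<alpha>" "(2 * lam + 2 / real n) / (2 / real n) = \<alpha> + 1"
      using n by (simp_all add: \<alpha>_def field_simps)
    then show ?thesis by (simp only: c0_def)
  qed
  have "gen_fourier_kernel (2 / real n) x y = of_real c0 * (\<Sum>j. of_real (1 / c0) * (\<Sum>k. T (j, k)))"
    unfolding gen_fourier_kernel_def Let_def lam_def[symmetric] z_def[symmetric] \<xi>_def[symmetric, folded z_def]
      c row ..
  also have "\<dots> = of_real c0 * (of_real (1 / c0) * (\<Sum>j. \<Sum>k. T (j, k)))"
    by (subst suminf_mult) (use suminf_regroup(1)[OF n T] in auto)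
  also have "\<dots> = (\<Sum>j. \<Sum>k. T (j, k))" using c0 by simp
  also have "\<dots> = (\<Sum>N. \<Sum>p\<in>weighted_pairs n N. T p)" by (rule suminf_regroup(2)[OF n T])
  finally show ?thesis unfolding T_def kernel_term_sum_weighted_pairs .
qed

theorem theorem12:
  fixes n :: nat and x y :: "'a::euclidean_space"
  assumes "n > 0" and "DIM('a) \<ge> 2" and "x \<noteq> 0" and "y \<noteq> 0"
  shows "norm (gen_fourier_kernel (2 / real n) x y) \<le> 1"
proof -
  have "\<bar>(x \<bullet> y) / (norm x * norm y)\<bar> \<le> 1"
    using Cauchy_Schwarz_ineq2[of x y] assms by (simp add: abs_div divide_simps)
  then have "cos (arccos ((x \<bullet> y) / (norm x * norm y))) = (x \<bullet> y) / (norm x * norm y)"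
    by (intro cos_arccos_abs)
  moreover have "norm (\<Sum>N. (- (\<i> * of_real (real n * (norm x * norm y) powr (1 / real n)))) ^ N *
      of_real (kernel_coeff n ((real DIM('a) - 2) / 2) (cos (arccos ((x \<bullet> y) / (norm x * norm y)))) N)) \<le> 1"
    using assms by (intro norm_kernel_series_le_1) auto
  ultimately show ?thesis
    by (simp only: gen_fourier_kernel_eq_series[OF assms])
qed

end
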